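(* Let $\Omega=\mathbb{FP}^d$, where $\mathbb F\in\{\mathbb R,\mathbb C,\mathbb H\}$ and $d\ge1$, or $\mathbb F=\mathbb O$ and $d\in\{1,2\}$. There exists a unique $s^*\in[-2,-1]$ such that for all $s<s^*$, $I_{F_s}$ is minimized (among Borel probability measures on $\Omega$) exactly by the measures of the form $\mu_{ONB}$, and for $0>s>s^*$, $I_{F_s}$ is not minimized by $\mu_{ONB}$.
   Context: $\vartheta$ is the geodesic distance on $\mathbb{FP}^d$ normalized so that the diameter is $\pi$: for $\mathbb F=\mathbb R,\mathbb C,\mathbb H$, $\cos\vartheta(x,y)=2|\langle x,y\rangle|^2-1$ for unit representatives in $\mathbb F^{d+1}$; for $\mathbb F=\mathbb O$, viewing points as Hermitian $(d+1)\times(d+1)$ octonionic matrices $\Pi$ with $\Pi^2=\Pi$, $\operatorname{Tr}\Pi=1$, $\cos\vartheta(\Pi_1,\Pi_2)=\operatorname{Re}\operatorname{Tr}(\Pi_1\Pi_2+\Pi_2\Pi_1)-1$. For $s<0$, $F_s(t)=\frac1s(\arccos t)^{-s}$ and $I_{F_s}(\mu)=\int_\Omega\int_\Omega F_s(\cos\vartheta(x,y))\,d\mu(x)\,d\mu(y)=\frac1s\int_\Omega\int_\Omega\vartheta(x,y)^{-s}\,d\mu(x)\,d\mu(y)$. A measure of the form $\mu_{ONB}$ is $\frac1{d+1}\sum_{j=1}^{d+1}\delta_{e_j}$, where $e_1,\dots,e_{d+1}\in\mathbb{FP}^d$ satisfy $\vartheta(e_i,e_j)=\pi$ for $i\ne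 j$ (points corresponding to an orthonormal basis of $\mathbb F^{d+1}$). *)

theory Defs
  imports "HOL-Probability.Probability"
begin

section \<open>Real division algebras with conjugation\<close>

class conj_div_algebra = real_normed_div_algebra +
  fixes fconj :: "'a \<Rightarrow> 'a"
  assumes fconj_add: "fconj (x + y) = fconj x + fconj y"
    and fconj_mult: "fconj (x * y) = fconj y * fconj x"
    and fconj_fconj: "fconj (fconj x) = x"
    and mult_fconj: "x * fconj x = (norm x)\<^sup>2 *\<^sub>R 1"

instantiation real :: conj_div_algebra
begin
definition fconj_real :: "real \<Rightarrow> real" where "fconj_real x = x"
instance by standard (auto simp: fconj_real_def power2_eq_square)
end

instantiation complex :: conj_div_algebra
begin
definition fconj_complex :: "complex \<Rightarrow> complex" where "fconj_complex = cnj"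
instance
  by standard (auto simp: fconj_complex_def complex_norm_square[symmetric] scaleR_conv_of_real)
end

section \<open>Quaternions\<close>

datatype quat = Quat (qRe: real) (qI: real) (qJ: real) (qK: real)

lemma quat_eq_iff:
  "x = y \<longleftrightarrow> qRe x = qRe y \<and> qI x = qI y \<and> qJ x = qJ y \<and> qK x = qK y"
  by (cases x; cases y) auto

instantiation quat :: real_vector
begin

definition zero_quat :: quat where "0 = Quat 0 0 0 0"
definition plus_quat :: "quat \<Rightarrow> quat \<Rightarrow> quat" where
  "x + y = Quat (qRe x + qRe y) (qI x + qI y) (qJ x + qJ y) (qK x + qK y)"
definition minus_quat :: "quat \<Rightarrow> quat \<Rightarrow> quat" where
  "x - y = Quat (qRe x - qRe y) (qI x - qI y) (qJ x - qJ y) (qK x - qK y)"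
definition uminus_quat :: "quat \<Rightarrow> quat" where
  "- x = Quat (- qRe x) (- qI x) (- qJ x) (- qK x)"
definition scaleR_quat :: "real \<Rightarrow> quat \<Rightarrow> quat" where
  "r *\<^sub>R x = Quat (r * qRe x) (r * qI x) (r * qJ x) (r * qK x)"
instance
  by standard (auto simp: zero_quat_def plus_quat_def minus_quat_def uminus_quat_def
      scaleR_quat_def algebra_simps)

end

instantiation quat :: real_inner
begin

definition inner_quat :: "quat \<Rightarrow> quat \<Rightarrow> real" where
  "x \<bullet> y = qRe x * qRe y + qI x * qI y + qJ x * qJ y + qK x * qK y"
definition norm_quat :: "quat \<Rightarrow> real" where
  "norm x = sqrt (x \<bullet> x)" for x :: quat
definition sgn_quat :: "quat \<Rightarrow> quat" where
  "sgn x = x /\<^sub>R norm x" for x :: quat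
definition dist_quat :: "quat \<Rightarrow> quat \<Rightarrow> real" where
  "dist x y = norm (x - y)" for x y :: quat
definition uniformity_quat :: "(quat \<times> quat) filter" where
  "uniformity_quat = (INF e\<in>{0<..}. principal {(x, y). dist x y < e})"
definition open_quat :: "quat set \<Rightarrow> bool" where
  "open_quat U = (\<forall>x\<in>U. eventually (\<lambda>(x', y). x' = x \<longrightarrow> y \<in> U) uniformity)"

instance
proof
  fix x y z :: quat and a b r :: real
  show "0 \<le> x \<bullet> x"
    by (simp add: inner_quat_def)
  show "(x \<bullet> x = 0) = (x = 0)"
    by (auto simp: inner_quat_def zero_quat_def quat_eq_iff add_nonneg_eq_0_iff)
qed (auto simp: zero_quat_def plus_quat_def minus_quat_def uminus_quat_def scaleR_quat_def
    inner_quat_def norm_quat_def sgn_quat_def dist_quat_def uniformity_quat_def open_quat_def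
    algebra_simps)

end

instantiation quat :: conj_div_algebra
begin

definition one_quat :: quat where "1 = Quat 1 0 0 0"

definition times_quat :: "quat \<Rightarrow> quat \<Rightarrow> quat" where
  "x * y = Quat
    (qRe x * qRe y - qI x * qI y - qJ x * qJ y - qK x * qK y)
    (qRe x * qI y + qI x * qRe y + qJ x * qK y - qK x * qJ y)
    (qRe x * qJ y - qI x * qK y + qJ x * qRe y + qK x * qI y)
    (qRe x * qK y + qI x * qJ y - qJ x * qI y + qK x * qRe y)"

definition fconj_quat :: "quat \<Rightarrow> quat" where
  "fconj x = Quat (qRe x) (- qI x) (- qJ x) (- qK x)"

definition inverse_quat :: "quat \<Rightarrow> quat" where
  "inverse_quat x = fconj x /\<^sub>R (x \<bullet> x)"

definition divide_quat :: "quat \<Rightarrow> quat \<Rightarrow> quat" where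
  "divide_quat x y = x * inverse y"

instance
proof
  fix x y z :: quat and r :: real
  have l: "fconj x * x = (x \<bullet> x) *\<^sub>R 1" and r: "x * fconj x = (x \<bullet> x) *\<^sub>R 1"
    by (auto simp: times_quat_def one_quat_def fconj_quat_def scaleR_quat_def inner_quat_def
        algebra_simps)
  have s: "(c *\<^sub>R x) * y = c *\<^sub>R (x * y)" "x * (c *\<^sub>R y) = c *\<^sub>R (x * y)" for c and x y :: quat
    by (auto simp: times_quat_def scaleR_quat_def algebra_simps)
  show "inverse x * x = 1" if "x \<noteq> 0"
    using that by (simp add: inverse_quat_def s l)
  show "x * inverse x = 1" if "x \<noteq> 0"
    using that by (simp add: inverse_quat_def s r)
  show "norm (x * y) = norm x * norm y"
    unfolding norm_quat_def real_sqrt_mult[symmetric]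
    by (rule arg_cong[of _ _ sqrt]) (simp add: inner_quat_def times_quat_def algebra_simps)
  show "x * fconj x = (norm x)\<^sup>2 *\<^sub>R 1"
    by (simp add: r power2_norm_eq_inner)
qed (auto simp: quat_eq_iff zero_quat_def one_quat_def plus_quat_def scaleR_quat_def
    times_quat_def fconj_quat_def inverse_quat_def divide_quat_def algebra_simps)

end

section \<open>Octonions\<close>

text \<open>
  The Cayley-Dickson double of the quaternions. Octonions are neither commutative nor
  associative, so only the additive structure and a bare product are instantiated.
\<close>

datatype octonion = Oct (oL: quat) (oR: quat)

lemma octonion_eq_iff: "x = y \<longleftrightarrow> oL x = oL y \<and> oR x = oR y"
  by (cases x; cases y) auto

instantiation octonion :: "{ab_group_add, one, times}"
begin

definition zero_octonion :: octonion where "0 = Oct 0 0"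
definition one_octonion :: octonion where "1 = Oct 1 0"
definition plus_octonion :: "octonion \<Rightarrow> octonion \<Rightarrow> octonion" where
  "x + y = Oct (oL x + oL y) (oR x + oR y)"
definition minus_octonion :: "octonion \<Rightarrow> octonion \<Rightarrow> octonion" where
  "x - y = Oct (oL x - oL y) (oR x - oR y)"
definition uminus_octonion :: "octonion \<Rightarrow> octonion" where
  "- x = Oct (- oL x) (- oR x)"
definition times_octonion :: "octonion \<Rightarrow> octonion \<Rightarrow> octonion" where
  "x * y = Oct (oL x * oL y - fconj (oR y) * oR x) (oR y * oL x + oR x * fconj (oL y))"

instance
  by standard (auto simp: zero_octonion_def plus_octonion_def minus_octonion_def
      uminus_octonion_def octonion_eq_iff)

end

definition oconj :: "octonion \<Rightarrow> octonion" where
  "oconj x = Oct (fconj (oL x)) (- oR x)"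

definition oRe :: "octonion \<Rightarrow> real" where
  "oRe x = qRe (oL x)"

definition onormsq :: "octonion \<Rightarrow> real" where
  "onormsq x = (norm (oL x))\<^sup>2 + (norm (oR x))\<^sup>2"

text \<open>The composition property, which pins down the sign conventions of the product.\<close>

lemma onormsq_mult: "onormsq (x * y) = onormsq x * onormsq y"
proof -
  have adj: "u \<bullet> (fconj v * w) = (v * u) \<bullet> w" "(u * v) \<bullet> w = u \<bullet> (w * fconj v)" for u v w :: quat
    by (simp_all add: inner_quat_def times_quat_def fconj_quat_def algebra_simps)
  have n: "norm (fconj u) = norm u" for u :: quat
    by (simp add: norm_quat_def inner_quat_def fconj_quat_def)
  have c: "(oL x * oL y) \<bullet> (fconj (oR y) * oR x) = (oR y * oL x) \<bullet> (oR x * fconj (oL y))"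
    by (simp add: adj fconj_mult mult.assoc)
  have "(norm (u - v))\<^sup>2 = (norm u)\<^sup>2 + (norm v)\<^sup>2 - 2 * (u \<bullet> v)"
    "(norm (u + v))\<^sup>2 = (norm u)\<^sup>2 + (norm v)\<^sup>2 + 2 * (u \<bullet> v)" for u v :: quat
    by (simp_all add: power2_norm_eq_inner inner_simps inner_commute)
  then show ?thesis
    unfolding onormsq_def times_octonion_def octonion.sel
    by (simp only: c norm_mult n power_mult_distrib) (simp add: algebra_simps)
qed

lemma mult_oconj: "x * oconj x = Oct (onormsq x *\<^sub>R 1) 0"
proof -
  have l: "fconj u * u = (norm u)\<^sup>2 *\<^sub>R 1" and r: "u * fconj u = (norm u)\<^sup>2 *\<^sub>R 1" for u :: quat
    by (simp_all add: power2_norm_eq_inner times_quat_def one_quat_def fconj_quat_def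
        scaleR_quat_def inner_quat_def algebra_simps)
  have "fconj (- u) = - fconj u" for u :: quat
    by (simp add: fconj_quat_def uminus_quat_def)
  then show ?thesis
    by (simp add: onormsq_def times_octonion_def oconj_def fconj_fconj l r scaleR_left.add)
qed

section \<open>Projective spaces over the associative division algebras\<close>

text \<open>
  Points are the (left) lines through the origin of \<open>\<F>\<^sup>n\<close>, where
  \<open>n = d + 1\<close> is the cardinality of the index type.  The Hermitian form is linear in its
  left argument, so \<open>\<bar>\<langle>x,y\<rangle>\<bar>\<close> only depends on the lines spanned by unit vectors
  \<open>x\<close>, \<open>y\<close>, also over the noncommutative quaternions.
\<close>

definition herm :: "'a::conj_div_algebra ^ 'n \<Rightarrow> 'a ^ 'n \<Rightarrow> 'a" where
  "herm x y = (\<Sum>i\<in>UNIV. x $ i * fconj (y $ i))"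

definition line :: "'a::conj_div_algebra ^ 'n \<Rightarrow> ('a ^ 'n) set" where
  "line x = range (\<lambda>c. c *s x)"

definition proj_space :: "('a::conj_div_algebra ^ 'n) set set" where
  "proj_space = line ` {x. x \<noteq> 0}"

definition unit_rep :: "('a::conj_div_algebra ^ 'n) set \<Rightarrow> 'a ^ 'n" where
  "unit_rep L = (SOME x. x \<in> L \<and> norm x = 1)"

definition proj_dist :: "('a::conj_div_algebra ^ 'n) set \<Rightarrow> ('a ^ 'n) set \<Rightarrow> real" where
  "proj_dist L L' = arccos (2 * (norm (herm (unit_rep L) (unit_rep L')))\<^sup>2 - 1)"

lemma norm_fconj: "norm (fconj x) = norm (x :: 'a::conj_div_algebra)"
proof (cases "x = 0")
  case True
  have "fconj (0::'a) = 0"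
    using fconj_add[of "0::'a" 0] by simp
  with True show ?thesis by simp
next
  case False
  have "norm x * norm (fconj x) = (norm x)\<^sup>2"
    by (simp add: norm_mult[symmetric] mult_fconj)
  with False show ?thesis
    by (simp add: power2_eq_square)
qed

lemma herm_scale: "herm (a *s x) (b *s y) = a * herm x y * fconj b"
  by (simp add: herm_def fconj_mult sum_distrib_left sum_distrib_right mult.assoc)

lemma norm_vector_scalar_mult: "norm (a *s x) = norm a * norm (x :: 'a::conj_div_algebra ^ 'n)"
  by (simp add: norm_vec_def norm_mult L2_set_right_distrib)

lemma unit_rep_scale:
  assumes L: "L \<in> proj_space" and x: "x \<in> L" "norm x = 1"
  obtains a where "norm a = 1" "unit_rep L = a *s x"
proof -
  from L obtain z where z: "z \<noteq> 0" "L = line z"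
    by (auto simp: proj_space_def)
  have u: "unit_rep L \<in> L \<and> norm (unit_rep L) = 1"
    unfolding unit_rep_def using x by (metis (mono_tags, lifting) someI)
  from x z obtain c where c: "x = c *s z" by (auto simp: line_def)
  from u z obtain b where b: "unit_rep L = b *s z" by (auto simp: line_def)
  from c x have "c \<noteq> 0" by auto
  then have eq: "unit_rep L = (b * inverse c) *s x"
    unfolding b c by (simp add: vec_eq_iff mult.assoc[symmetric])
       (simp add: mult.assoc)
  then have "norm (b * inverse c) = 1"
    using u x norm_vector_scalar_mult[of "b * inverse c" x] by simp
  with eq show ?thesis using that by blast
qed

text \<open>The distance does not depend on the choice of the unit representatives.\<close>

lemma proj_dist_unit:
  assumes "L \<in> proj_space" "x \<in> L" "norm x = 1" "L' \<in> proj_space" "y \<in> L'" "norm y = 1"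
  shows "proj_dist L L' = arccos (2 * (norm (herm x y))\<^sup>2 - 1)"
proof -
  obtain a where a: "norm a = 1" "unit_rep L = a *s x"
    using unit_rep_scale assms(1-3) by blast
  obtain b where b: "norm b = 1" "unit_rep L' = b *s y"
    using unit_rep_scale assms(4-6) by blast
  show ?thesis
    by (simp add: proj_dist_def a b herm_scale norm_mult norm_fconj)
qed

section \<open>Octonionic projective spaces\<close>

text \<open>
  The library product of matrices requires an associative entry type.  Its \<open>*\<close> on
  vectors is componentwise and hence not the product needed here either.
\<close>

definition omat_mult :: "octonion ^ 'n ^ 'n \<Rightarrow> octonion ^ 'n ^ 'n \<Rightarrow> octonion ^ 'n ^ 'n" where
  "omat_mult A B = (\<chi> i j. \<Sum>k\<in>UNIV. A $ i $ k * B $ k $ j)"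

definition otrace :: "octonion ^ 'n ^ 'n \<Rightarrow> octonion" where
  "otrace A = (\<Sum>i\<in>UNIV. A $ i $ i)"

definition oct_proj_space :: "(octonion ^ 'n ^ 'n) set" where
  "oct_proj_space =
     {P. (\<forall>i j. P $ j $ i = oconj (P $ i $ j)) \<and> omat_mult P P = P \<and> otrace P = 1}"

definition oct_proj_dist :: "octonion ^ 'n ^ 'n \<Rightarrow> octonion ^ 'n ^ 'n \<Rightarrow> real" where
  "oct_proj_dist P Q = arccos (oRe (otrace (omat_mult P Q + omat_mult Q P)) - 1)"

section \<open>Energies of Borel probability measures\<close>

text \<open>
  The open sets of the metric \<open>\<theta>\<close> on \<open>X\<close>, written out because the facts about
  \<open>Metric_space.mtopology\<close> presuppose a proof of the triangle inequality.
\<close>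

definition dist_open :: "'p set \<Rightarrow> ('p \<Rightarrow> 'p \<Rightarrow> real) \<Rightarrow> 'p set \<Rightarrow> bool" where
  "dist_open X \<theta> U \<longleftrightarrow>
     U \<subseteq> X \<and> (\<forall>x\<in>U. \<exists>r>0. \<forall>y\<in>X. \<theta> x y < r \<longrightarrow> y \<in> U)"

definition borel_probs :: "'p set \<Rightarrow> ('p \<Rightarrow> 'p \<Rightarrow> real) \<Rightarrow> 'p measure set" where
  "borel_probs X \<theta> =
     {M. prob_space M \<and> sets M = sets (sigma X {U. dist_open X \<theta> U})}"

definition F_pow :: "real \<Rightarrow> real \<Rightarrow> real" where
  "F_pow s t = 1 / s * arccos t powr (- s)"

definition energy :: "('p \<Rightarrow> 'p \<Rightarrow> real) \<Rightarrow> (real \<Rightarrow> real) \<Rightarrow> 'p measure \<Rightarrow> real" where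
  "energy \<theta> F M = (\<integral>x. (\<integral>y. F (cos (\<theta> x y)) \<partial>M) \<partial>M)"

definition is_minimizer ::
    "'p set \<Rightarrow> ('p \<Rightarrow> 'p \<Rightarrow> real) \<Rightarrow> (real \<Rightarrow> real) \<Rightarrow> 'p measure \<Rightarrow> bool" where
  "is_minimizer X \<theta> F M \<longleftrightarrow>
     M \<in> borel_probs X \<theta> \<and> (\<forall>N\<in>borel_probs X \<theta>. energy \<theta> F M \<le> energy \<theta> F N)"

definition is_onb_measure ::
    "'p set \<Rightarrow> ('p \<Rightarrow> 'p \<Rightarrow> real) \<Rightarrow> nat \<Rightarrow> 'p measure \<Rightarrow> bool" where
  "is_onb_measure X \<theta> d M \<longleftrightarrow>
     M \<in> borel_probs X \<theta> \<and>
     (\<exists>e. (\<forall>i\<in>{1..d+1}. e i \<in> X) \<and>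
          (\<forall>i\<in>{1..d+1}. \<forall>j\<in>{1..d+1}. i \<noteq> j \<longrightarrow> \<theta> (e i) (e j) = pi) \<and>
          (\<forall>A\<in>sets M. measure M A = 1 / real (d + 1) * (\<Sum>j\<in>{1..d+1}. measure (return M (e j)) A)))"

definition is_onb_threshold ::
    "'p set \<Rightarrow> ('p \<Rightarrow> 'p \<Rightarrow> real) \<Rightarrow> nat \<Rightarrow> real \<Rightarrow> bool" where
  "is_onb_threshold X \<theta> d t \<longleftrightarrow>
     (\<forall>s<t. \<forall>M. is_minimizer X \<theta> (F_pow s) M \<longleftrightarrow> is_onb_measure X \<theta> d M) \<and>
     (\<forall>s. t < s \<and> s < 0 \<longrightarrow> (\<forall>M. is_onb_measure X \<theta> d M \<longrightarrow> \<not> is_minimizer X \<theta> (F_pow s) M))"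

end

theory Submission
  imports Defs
begin

text \<open>
  Write \<open>p = -s > 0\<close> and let \<open>J p M\<close> be the mean of \<open>(\<theta> / \<pi>)\<^sup>p\<close> under \<open>M \<times> M\<close>.
  Since the energy is a negative multiple of \<open>J p M\<close>, minimizing it means maximizing \<open>J p\<close>,
  and an orthonormal basis gives the value \<open>d / (d + 1)\<close>.  The set \<open>S\<close> of exponents for which
  this is the maximum decides everything, and the threshold is \<open>- Inf S\<close>.

  As \<open>0 \<le> \<theta> / \<pi> \<le> 1\<close>, raising \<open>p\<close> can only decrease \<open>J p M\<close>, and strictly so unless
  \<open>\<theta>\<close> takes almost surely only the values \<open>0\<close> and \<open>\<pi>\<close>.  Hence every exponent above
  \<open>Inf S\<close> has the bases as maximizers, and a maximizer there has almost surely
  \<open>\<theta> \<in> {0, \<pi>}\<close> (lemma \<open>mean_power_mono\<close>).  It remains to see three things.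

  The exponent \<open>2\<close> is in \<open>S\<close> (lemma \<open>two_onb_exponent\<close>).  Each point is represented by a rank
  one projector \<open>\<Phi> x\<close>, and \<open>k = \<langle>\<Phi> x, \<Phi> y\<rangle>\<close> satisfies \<open>1 - k = sin\<^sup>2 (\<theta> / 2)\<close>.
  The concavity of the sine gives \<open>(\<theta> / \<pi>)\<^sup>2 \<le> 1 - k\<close>, with equality at both ends.  The mean of \<open>k\<close>
  is the squared norm of the mean projector, which has trace \<open>1\<close>, so it is at least
  \<open>1 / (d + 1)\<close> by the Cauchy-Schwarz inequality against the identity matrix.

  No exponent below \<open>1\<close> is in \<open>S\<close> (lemma \<open>onb_exponents_ge_1\<close>): averaging an orthonormal basis with
  the one obtained by turning its first two vectors by half a right angle replaces some values
  \<open>0\<close> and \<open>1\<close> of \<open>\<theta> / \<pi>\<close> by \<open>1 / 2\<close>, which is profitable as soon as \<open>(1 / 2)\<^sup>p > 1 / 2\<close>.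

  A maximizer with \<open>\<theta> \<in> {0, \<pi>}\<close> is a basis measure (lemma \<open>onb_if_kernel_01\<close>): it makes the
  Cauchy-Schwarz inequality above an equality, so its mean projector is the identity over \<open>d + 1\<close>,
  and then almost every point lies in an atom of mass exactly \<open>1 / (d + 1)\<close>.

  The argument sees the division algebra only through \<open>\<Phi>\<close>, in the form of the locale
  \<open>projector_embedding\<close>.  Over the octonions the one delicate requirement is
  \<open>\<langle>\<Phi> x, \<Phi> y\<rangle> \<ge> 0\<close>, because the entries of two projectors need not lie in a
  common associative subalgebra; it is lemma \<open>oct_kernel_nonneg\<close>.
\<close>

section \<open>Scalar inequalities\<close>

text \<open>
  The sine is concave on \<open>[0, \<pi>]\<close>, so on \<open>[0, \<pi> / 2]\<close> it lies above its chord.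
\<close>

lemma sin_half_ge_chord:
  assumes "0 \<le> t" "t \<le> pi"
  shows "t / pi \<le> sin (t / 2)"
proof -
  have "convex_on {0..pi} (\<lambda>x. - sin x)"
    by (rule f''_ge0_imp_convex[where f' = "\<lambda>x. - cos x" and f'' = sin])
       (auto intro!: derivative_eq_intros sin_ge_zero)
  then have "- sin ((1 - t / pi) *\<^sub>R 0 + (t / pi) *\<^sub>R (pi / 2))
      \<le> (1 - t / pi) * (- sin 0) + (t / pi) * (- sin (pi / 2))"
    using assms by (intro convex_onD) (auto simp: field_simps)
  then show ?thesis by simp
qed

text \<open>
  For \<open>k = \<bar>\<langle>x, y\<rangle>\<bar>\<^sup>2\<close> this is \<open>(\<theta>(x, y) / \<pi>)\<^sup>p\<close>.
\<close>

definition angle_power :: "real \<Rightarrow> real \<Rightarrow> real" where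
  "angle_power p k = (arccos (2 * k - 1) / pi) powr p"

lemma arccos_kernel_bounds:
  assumes "0 \<le> k" "k \<le> 1"
  shows "0 \<le> arccos (2 * k - 1)" "arccos (2 * k - 1) \<le> pi"
  using assms by (auto intro: arccos_lbound arccos_ubound)

lemma angle_power_0 [simp]: "angle_power p 0 = 1"
  and angle_power_1 [simp]: "angle_power p 1 = 0"
  and angle_power_half [simp]: "angle_power p (1 / 2) = (1 / 2) powr p"
  by (simp_all add: angle_power_def)

lemma angle_power_bounds:
  assumes "0 \<le> k" "k \<le> 1" "0 < p"
  shows "0 \<le> angle_power p k" "angle_power p k \<le> 1"
proof -
  show "0 \<le> angle_power p k" by (simp add: angle_power_def)
  have "(arccos (2 * k - 1) / pi) powr p \<le> 1 powr p"
    using arccos_kernel_bounds[OF assms(1,2)] assms(3) by (intro powr_mono2) auto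
  then show "angle_power p k \<le> 1" by (simp add: angle_power_def)
qed

text \<open>
  In terms of \<open>\<theta> = arccos (2 k - 1)\<close> the right-hand side is \<open>sin\<^sup>2 (\<theta> / 2)\<close>, so this is
  the square of the chord estimate.  The right-hand side is affine in \<open>k\<close>, which makes its mean
  computable.
\<close>

lemma angle_power_2_le:
  assumes "0 \<le> k" "k \<le> 1"
  shows "angle_power 2 k \<le> 1 - k"
proof -
  define t where "t = arccos (2 * k - 1)"
  have t: "0 \<le> t" "t \<le> pi" using arccos_kernel_bounds[OF assms] by (auto simp: t_def)
  have "cos t = 2 * k - 1" using assms by (simp add: t_def)
  moreover have "cos t = 1 - 2 * (sin (t / 2))\<^sup>2"
    using cos_double_sin[of "t / 2"] by simp
  ultimately have k: "1 - k = (sin (t / 2))\<^sup>2" by simp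
  have "angle_power 2 k = (t / pi)\<^sup>2"
    using t by (simp add: angle_power_def t_def)
  also have "\<dots> \<le> (sin (t / 2))\<^sup>2"
    using t sin_half_ge_chord[OF t] by (intro power_mono) auto
  finally show ?thesis by (simp add: k)
qed

lemma angle_power_antimono:
  assumes "0 \<le> k" "k \<le> 1" "p \<le> q"
  shows "angle_power q k \<le> angle_power p k"
  unfolding angle_power_def
  using arccos_kernel_bounds[OF assms(1,2)] assms(3) by (intro powr_mono') auto

lemma angle_power_eqD:
  assumes "0 \<le> k" "k \<le> 1" "p < q" and eq: "angle_power q k = angle_power p k"
  shows "k = 0 \<or> k = 1"
proof (rule ccontr)
  assume "\<not> (k = 0 \<or> k = 1)"
  then have k: "0 < k" "k < 1" using assms by auto
  define t where "t = arccos (2 * k - 1)"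
  have "t < pi" "0 < t"
    using k arccos_lt_bounded[of "2 * k - 1"] by (auto simp: t_def)
  then have "(t / pi) powr q < (t / pi) powr p"
    using \<open>p < q\<close> by (intro powr_less_mono') auto
  then show False using eq by (simp add: angle_power_def t_def)
qed

text \<open>
  Nothing is known about \<open>arccos\<close> outside \<open>[-1, 1]\<close>; clamping the argument gives a function that
  is continuous on the whole line and agrees with the original one wherever a kernel takes its values.
\<close>

lemma clamped_angle_power_measurable:
  assumes "0 < p"
  shows "(\<lambda>k. angle_power p (max 0 (min 1 k))) \<in> borel_measurable borel"
proof -
  have "continuous_on UNIV (\<lambda>k. (arccos (2 * max 0 (min 1 k) - 1) / pi) powr p)"
    using assms by (intro continuous_on_powr' continuous_intros) (auto intro!: arccos_lbound divide_nonneg_pos)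
  then show ?thesis unfolding angle_power_def by (rule borel_measurable_continuous_onI)
qed

section \<open>Iterated integrals of bounded kernels\<close>

context prob_space
begin

text \<open>
  The energy is an iterated integral; passing to the product measure is what turns equality of two
  integrals of ordered kernels into almost sure equality of the kernels.
\<close>

lemma iterated_integral_mono:
  fixes f g :: "'a \<times> 'a \<Rightarrow> real"
  assumes [measurable]: "f \<in> borel_measurable (M \<Otimes>\<^sub>M M)" "g \<in> borel_measurable (M \<Otimes>\<^sub>M M)"
    and f: "\<And>x y. x \<in> space M \<Longrightarrow> y \<in> space M \<Longrightarrow> 0 \<le> f (x, y)"
    and fg: "\<And>x y. x \<in> space M \<Longrightarrow> y \<in> space M \<Longrightarrow> f (x, y) \<le> g (x, y)"
    and g: "\<And>x y. x \<in> space M \<Longrightarrow> y \<in> space M \<Longrightarrow> g (x, y) \<le> 1"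
  shows "(\<integral>x. (\<integral>y. f (x, y) \<partial>M) \<partial>M) \<le> (\<integral>x. (\<integral>y. g (x, y) \<partial>M) \<partial>M)"
    and "(\<integral>x. (\<integral>y. f (x, y) \<partial>M) \<partial>M) = (\<integral>x. (\<integral>y. g (x, y) \<partial>M) \<partial>M) \<Longrightarrow>
      AE x in M. AE y in M. f (x, y) = g (x, y)"
proof -
  interpret P: pair_prob_space M M ..
  have b: "0 \<le> f z" "f z \<le> g z" "g z \<le> 1" if "z \<in> space (M \<Otimes>\<^sub>M M)" for z
    using that f fg g by (auto simp: space_pair_measure)
  have If: "integrable (M \<Otimes>\<^sub>M M) f" and Ig: "integrable (M \<Otimes>\<^sub>M M) g"
    by (rule P.integrable_const_bound[of _ 1], use b in \<open>force intro!: AE_I2\<close>, measurable)+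
  have ef: "(\<integral>x. (\<integral>y. f (x, y) \<partial>M) \<partial>M) = integral\<^sup>L (M \<Otimes>\<^sub>M M) f"
    and eg: "(\<integral>x. (\<integral>y. g (x, y) \<partial>M) \<partial>M) = integral\<^sup>L (M \<Otimes>\<^sub>M M) g"
    using P.integral_fst'[OF If] P.integral_fst'[OF Ig] by simp_all
  show "(\<integral>x. (\<integral>y. f (x, y) \<partial>M) \<partial>M) \<le> (\<integral>x. (\<integral>y. g (x, y) \<partial>M) \<partial>M)"
    unfolding ef eg using b by (intro integral_mono If Ig)
  assume "(\<integral>x. (\<integral>y. f (x, y) \<partial>M) \<partial>M) = (\<integral>x. (\<integral>y. g (x, y) \<partial>M) \<partial>M)"
  then have "integral\<^sup>L (M \<Otimes>\<^sub>M M) (\<lambda>z. g z - f z) = 0"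
    unfolding ef eg by (simp add: If Ig)
  then have "AE z in M \<Otimes>\<^sub>M M. g z - f z = 0"
    using b by (subst (asm) integral_nonneg_eq_0_iff_AE) (auto intro!: If Ig)
  then have "AE z in M \<Otimes>\<^sub>M M. f z = g z" by eventually_elim simp
  then show "AE x in M. AE y in M. f (x, y) = g (x, y)"
    by (rule P.AE_pair)
qed

lemma iterated_integral_cong_AE:
  fixes f g :: "'a \<times> 'a \<Rightarrow> real"
  assumes [measurable]: "f \<in> borel_measurable (M \<Otimes>\<^sub>M M)" "g \<in> borel_measurable (M \<Otimes>\<^sub>M M)"
    and ae: "AE x in M. AE y in M. f (x, y) = g (x, y)"
  shows "(\<integral>x. (\<integral>y. f (x, y) \<partial>M) \<partial>M) = (\<integral>x. (\<integral>y. g (x, y) \<partial>M) \<partial>M)"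
proof (rule integral_cong_AE)
  show "AE x in M. (\<integral>y. f (x, y) \<partial>M) = (\<integral>y. g (x, y) \<partial>M)"
    using ae AE_space by eventually_elim (rule integral_cong_AE, auto)
qed measurable

end

section \<open>Spaces embedded as projectors of trace one\<close>

text \<open>
  The properties of a projective space that the argument uses.  The map \<open>\<Phi>\<close> sends a point to
  its rank one projector in a Euclidean space of matrices, whose inner product is the trace form, and
  \<open>u\<close> is the identity matrix, so that \<open>\<Phi> x \<bullet> u\<close> is the trace of \<open>\<Phi> x\<close>.  The points
  \<open>pt v\<close> with real homogeneous coordinates are a copy of the real projective space; they supply
  all the test configurations.
\<close>

locale projector_embedding =
  fixes X :: "'p set" and \<theta> :: "'p \<Rightarrow> 'p \<Rightarrow> real"
    and \<Phi> :: "'p \<Rightarrow> 'e::euclidean_space" and u :: 'e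
    and pt :: "real ^ 'n \<Rightarrow> 'p" and d :: nat
  assumes dim: "CARD('n::finite) = d + 1" "d \<ge> 1"
    and unit: "x \<in> X \<Longrightarrow> \<Phi> x \<bullet> \<Phi> x = 1"
    and trace: "x \<in> X \<Longrightarrow> \<Phi> x \<bullet> u = 1"
    and u_norm: "u \<bullet> u = real (d + 1)"
    and kernel_nonneg: "x \<in> X \<Longrightarrow> y \<in> X \<Longrightarrow> 0 \<le> \<Phi> x \<bullet> \<Phi> y"
    and \<theta>_eq: "x \<in> X \<Longrightarrow> y \<in> X \<Longrightarrow> \<theta> x y = arccos (2 * (\<Phi> x \<bullet> \<Phi> y) - 1)"
    and pt_in: "norm v = 1 \<Longrightarrow> pt v \<in> X"
    and pt_kernel: "norm v = 1 \<Longrightarrow> norm w = 1 \<Longrightarrow> \<Phi> (pt v) \<bullet> \<Phi> (pt w) = (v \<bullet> w)\<^sup>2"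
begin

lemma kernel_le_1: "x \<in> X \<Longrightarrow> y \<in> X \<Longrightarrow> \<Phi> x \<bullet> \<Phi> y \<le> 1"
  using norm_cauchy_schwarz[of "\<Phi> x" "\<Phi> y"] unit by (simp add: norm_eq_sqrt_inner)

lemma kernel_eq_1_iff:
  assumes "x \<in> X" "y \<in> X"
  shows "\<Phi> x \<bullet> \<Phi> y = 1 \<longleftrightarrow> \<Phi> x = \<Phi> y"
proof -
  have "(\<Phi> x - \<Phi> y) \<bullet> (\<Phi> x - \<Phi> y) = 2 - 2 * (\<Phi> x \<bullet> \<Phi> y)"
    using assms by (simp add: inner_simps unit inner_commute)
  then show ?thesis using assms unit by (metis diff_self eq_iff_diff_eq_0 inner_eq_zero_iff mult_cancel_left2 zero_neq_numeral)
qed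

lemmas kernel_bounds = kernel_nonneg kernel_le_1

lemma \<theta>_bounds:
  assumes "x \<in> X" "y \<in> X"
  shows "0 \<le> \<theta> x y" "\<theta> x y \<le> pi"
  using arccos_kernel_bounds[OF kernel_bounds] assms by (auto simp: \<theta>_eq)

lemma cos_\<theta>:
  assumes "x \<in> X" "y \<in> X"
  shows "cos (\<theta> x y) = 1 - (dist (\<Phi> x) (\<Phi> y))\<^sup>2"
proof -
  have "(dist (\<Phi> x) (\<Phi> y))\<^sup>2 = 2 - 2 * (\<Phi> x \<bullet> \<Phi> y)"
    using assms by (simp add: dist_norm power2_norm_eq_inner inner_simps unit inner_commute)
  moreover have "cos (\<theta> x y) = 2 * (\<Phi> x \<bullet> \<Phi> y) - 1"
    using assms kernel_bounds[OF assms] by (simp add: \<theta>_eq)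
  ultimately show ?thesis by simp
qed

lemma \<theta>_eq_pi_iff:
  assumes "x \<in> X" "y \<in> X"
  shows "\<theta> x y = pi \<longleftrightarrow> \<Phi> x \<bullet> \<Phi> y = 0"
proof
  assume "\<theta> x y = pi"
  then have "cos (\<theta> x y) = -1" by simp
  then show "\<Phi> x \<bullet> \<Phi> y = 0" using kernel_bounds[OF assms] assms by (simp add: \<theta>_eq)
qed (simp add: \<theta>_eq assms)

text \<open>
  The chord is shorter than the arc.
\<close>

lemma dist_le_\<theta>:
  assumes "x \<in> X" "y \<in> X"
  shows "dist (\<Phi> x) (\<Phi> y) \<le> \<theta> x y"
proof -
  have "(dist (\<Phi> x) (\<Phi> y))\<^sup>2 = 1 - cos (\<theta> x y)" using cos_\<theta>[OF assms] by simp
  also have "\<dots> = 2 * (sin (\<theta> x y / 2))\<^sup>2" using cos_double_sin[of "\<theta> x y / 2"] by simp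
  also have "\<dots> \<le> 2 * (\<theta> x y / 2)\<^sup>2"
    using abs_sin_x_le_abs_x[of "\<theta> x y / 2"] by (auto simp only: power2_le_iff_abs_le abs_le_square_iff intro!: mult_left_mono)
  also have "\<dots> \<le> (\<theta> x y)\<^sup>2" by (simp add: power_divide)
  finally show ?thesis using \<theta>_bounds[OF assms] power2_le_imp_le by blast
qed

text \<open>
  The distance \<open>\<theta>\<close> is an increasing function of the Euclidean distance of the projectors, so it
  induces the topology pulled back along \<open>\<Phi>\<close>.
\<close>

lemma dist_open_iff:
  "dist_open X \<theta> U \<longleftrightarrow> (\<exists>O'. open O' \<and> U = \<Phi> -` O' \<inter> X)"
proof
  assume U: "dist_open X \<theta> U"
  have "\<exists>\<delta>>0. \<forall>y\<in>X. dist (\<Phi> x) (\<Phi> y) < \<delta> \<longrightarrow> y \<in> U" if x: "x \<in> U" for x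
  proof -
    have xX: "x \<in> X" using U x by (auto simp: dist_open_def)
    obtain r where r: "r > 0" "\<And>y. y \<in> X \<Longrightarrow> \<theta> x y < r \<Longrightarrow> y \<in> U"
      using U x unfolding dist_open_def by blast
    \<comment> \<open>cosine is decreasing on \<open>[0, \<pi>]\<close> only, so the radius is cut off at \<open>\<pi>\<close>\<close>
    define r' where "r' = min r pi"
    have r': "0 < r'" "r' \<le> pi" "r' \<le> r" using r by (auto simp: r'_def)
    then have c: "cos r' < 1" using cos_monotone_0_pi[of 0 r'] by simp
    show ?thesis
    proof (intro exI[of _ "sqrt (1 - cos r')"] conjI ballI impI)
      show "0 < sqrt (1 - cos r')" using c by simp
      fix y assume y: "y \<in> X" and "dist (\<Phi> x) (\<Phi> y) < sqrt (1 - cos r')"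
      then have "(dist (\<Phi> x) (\<Phi> y))\<^sup>2 < (sqrt (1 - cos r'))\<^sup>2"
        by (intro power_strict_mono) auto
      then have "(dist (\<Phi> x) (\<Phi> y))\<^sup>2 < 1 - cos r'"
        using c by simp
      then have "cos r' < cos (\<theta> x y)"
        using cos_\<theta>[OF xX y] by linarith
      then have "\<theta> x y < r'"
        using cos_monotone_0_pi_le[of r' "\<theta> x y"] \<theta>_bounds[of x y] xX y r' by linarith
      then show "y \<in> U" using r' by (intro r(2) y) linarith
    qed
  qed
  then obtain \<delta> where \<delta>: "\<And>x. x \<in> U \<Longrightarrow> \<delta> x > 0"
    "\<And>x y. x \<in> U \<Longrightarrow> y \<in> X \<Longrightarrow> dist (\<Phi> x) (\<Phi> y) < \<delta> x \<Longrightarrow> y \<in> U" by metis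
  define W where "W = (\<Union>x\<in>U. ball (\<Phi> x) (\<delta> x))"
  have UX: "U \<subseteq> X" using U unfolding dist_open_def by blast
  have 1: "\<Phi> x \<in> W" if "x \<in> U" for x
    unfolding W_def using \<delta>(1)[OF that] by (intro UN_I[OF that]) simp
  have 2: "y \<in> U" if "\<Phi> y \<in> W" "y \<in> X" for y
  proof -
    from that(1) obtain x where "x \<in> U" "dist (\<Phi> x) (\<Phi> y) < \<delta> x"
      unfolding W_def UN_iff mem_ball by blast
    then show ?thesis using \<delta>(2) that(2) by blast
  qed
  have "open W" unfolding W_def by (intro open_UN ballI open_ball)
  moreover have "U = \<Phi> -` W \<inter> X" using UX 1 2 by blast
  ultimately show "\<exists>O'. open O' \<and> U = \<Phi> -` O' \<inter> X" by blast
next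
  assume "\<exists>O'. open O' \<and> U = \<Phi> -` O' \<inter> X"
  then obtain O' where O: "open O'" "U = \<Phi> -` O' \<inter> X" by blast
  have "\<exists>r>0. \<forall>y\<in>X. \<theta> x y < r \<longrightarrow> y \<in> U" if x: "x \<in> U" for x
  proof -
    have "x \<in> X" "\<Phi> x \<in> O'" using O(2) x by auto
    with O(1) obtain e where "e > 0" "ball (\<Phi> x) e \<subseteq> O'"
      using open_contains_ball[of O'] by blast
    moreover have "dist (\<Phi> x) (\<Phi> y) < e" if "y \<in> X" "\<theta> x y < e" for y
      using dist_le_\<theta>[OF \<open>x \<in> X\<close> that(1)] that(2) by linarith
    moreover have "y \<in> U" if "y \<in> X" "dist (\<Phi> x) (\<Phi> y) < e" for y
      using that \<open>ball (\<Phi> x) e \<subseteq> O'\<close> unfolding O(2) by auto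
    ultimately show ?thesis by blast
  qed
  moreover have "U \<subseteq> X" using O(2) by blast
  ultimately show "dist_open X \<theta> U" unfolding dist_open_def by blast
qed

definition borel_X :: "'p measure" where
  "borel_X = sigma X {U. dist_open X \<theta> U}"

lemma space_borel_X [simp]: "space borel_X = X"
  by (simp add: borel_X_def space_measure_of_conv)

text \<open>
  Consequently every Borel set is a union of fibres of \<open>\<Phi>\<close>, and no measure distinguishes two
  points with the same projector.
\<close>

lemma sets_borel_X: "sets borel_X = {\<Phi> -` B \<inter> X | B. B \<in> sets borel}"
proof -
  have "{\<Phi> -` B \<inter> X | B. B \<in> sigma_sets UNIV {S. open S}}
      = sigma_sets X {\<Phi> -` B \<inter> X | B. B \<in> {S. open S}}"
    by (rule sigma_sets_vimage_commute) simp
  moreover have "{\<Phi> -` B \<inter> X | B. B \<in> {S. open S}} = {U. dist_open X \<theta> U}"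
    by (auto simp: dist_open_iff)
  moreover have "{U. dist_open X \<theta> U} \<subseteq> Pow X" by (auto simp: dist_open_def)
  ultimately show ?thesis by (simp add: borel_X_def borel_def)
qed

abbreviation probs :: "'p measure set" where
  "probs \<equiv> borel_probs X \<theta>"

lemma probs_iff: "M \<in> probs \<longleftrightarrow> prob_space M \<and> sets M = sets borel_X"
  by (simp add: borel_probs_def borel_X_def)

lemma probsD:
  assumes "M \<in> probs"
  shows "prob_space M" "sets M = sets borel_X" "space M = X" "\<Phi> \<in> borel_measurable M"
proof -
  show p: "prob_space M" "sets M = sets borel_X" using assms by (auto simp: probs_iff)
  then show s: "space M = X" using sets_eq_imp_space_eq[OF p(2)] by simp
  show "\<Phi> \<in> borel_measurable M"
    by (rule measurableI) (auto simp: p s sets_borel_X)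
qed

text \<open>
  The quantity \<open>J p M\<close> to be maximized.
\<close>

definition mean_power :: "real \<Rightarrow> 'p measure \<Rightarrow> real" where
  "mean_power p M = (\<integral>x. (\<integral>y. angle_power p (\<Phi> x \<bullet> \<Phi> y) \<partial>M) \<partial>M)"

lemma energy_eq:
  assumes M: "M \<in> probs" and s: "s < 0"
  shows "energy \<theta> (F_pow s) M = (1 / s * pi powr (- s)) * mean_power (- s) M"
proof -
  have F: "F_pow s (cos (\<theta> x y)) = (1 / s * pi powr (- s)) * angle_power (- s) (\<Phi> x \<bullet> \<Phi> y)"
    if "x \<in> X" "y \<in> X" for x y
    using \<theta>_bounds[OF that] that
    by (simp add: F_pow_def angle_power_def \<theta>_eq[symmetric] arccos_cos powr_divide)
  have "energy \<theta> (F_pow s) M =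
      (\<integral>x. (\<integral>y. (1 / s * pi powr (- s)) * angle_power (- s) (\<Phi> x \<bullet> \<Phi> y) \<partial>M) \<partial>M)"
    unfolding energy_def by (intro Bochner_Integration.integral_cong refl F) (auto simp: probsD[OF M])
  then show ?thesis by (simp add: mean_power_def)
qed

lemma energy_le_iff:
  assumes "M \<in> probs" "N \<in> probs" "s < 0"
  shows "energy \<theta> (F_pow s) M \<le> energy \<theta> (F_pow s) N \<longleftrightarrow> mean_power (- s) N \<le> mean_power (- s) M"
proof -
  have "1 / s * pi powr (- s) < 0" using assms by (intro mult_neg_pos) auto
  then show ?thesis
    unfolding energy_eq[OF assms(1,3)] energy_eq[OF assms(2,3)] by (rule mult_le_cancel_left_neg)
qed

lemma kernel_measurable:
  assumes "M \<in> probs"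
  shows "(\<lambda>(x, y). \<Phi> x \<bullet> \<Phi> y) \<in> borel_measurable (M \<Otimes>\<^sub>M M)"
proof -
  note [measurable] = probsD(4)[OF assms]
  show ?thesis by measurable
qed

lemma angle_power_measurable:
  assumes M: "M \<in> probs" and "0 < p"
  shows "(\<lambda>(x, y). angle_power p (\<Phi> x \<bullet> \<Phi> y)) \<in> borel_measurable (M \<Otimes>\<^sub>M M)"
proof -
  have "(\<lambda>(x, y). angle_power p (max 0 (min 1 (\<Phi> x \<bullet> \<Phi> y)))) \<in> borel_measurable (M \<Otimes>\<^sub>M M)"
    using measurable_compose[OF kernel_measurable[OF M] clamped_angle_power_measurable[OF \<open>0 < p\<close>]]
    by (simp add: case_prod_beta')
  moreover have "max 0 (min 1 (\<Phi> x \<bullet> \<Phi> y)) = \<Phi> x \<bullet> \<Phi> y" if "x \<in> X" "y \<in> X" for x y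
    using kernel_bounds[OF that] by simp
  ultimately show ?thesis
    by (subst measurable_cong[where g = "\<lambda>(x, y). angle_power p (max 0 (min 1 (\<Phi> x \<bullet> \<Phi> y)))"])
       (auto simp: space_pair_measure probsD(3)[OF M])
qed

subsection \<open>The mean kernel and the exponent two\<close>

text \<open>
  With \<open>m\<close> the mean projector, linearity of the integral gives the value \<open>m \<bullet> m\<close> for the mean kernel.  As
  \<open>m\<close> has trace \<open>1\<close>, splitting off its component along the identity matrix leaves a nonnegative
  remainder; keeping that remainder in the formula serves both the lower bound and its equality case.
\<close>

lemma mean_kernel:
  assumes M: "M \<in> probs"
  defines "m \<equiv> \<integral>x. \<Phi> x \<partial>M"
  shows "x \<in> X \<Longrightarrow> (\<integral>y. \<Phi> x \<bullet> \<Phi> y \<partial>M) = \<Phi> x \<bullet> m"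
    and "(\<integral>x. (\<integral>y. \<Phi> x \<bullet> \<Phi> y \<partial>M) \<partial>M) = 1 / real (d + 1) + (norm (m - u /\<^sub>R real (d + 1)))\<^sup>2"
proof -
  interpret prob_space M by (rule probsD[OF M])
  have [measurable]: "\<Phi> \<in> borel_measurable M" by (rule probsD[OF M])
  have I: "integrable M \<Phi>"
    by (rule integrable_const_bound[of _ 1]) (auto simp: probsD(3)[OF M] norm_eq_sqrt_inner unit intro!: AE_I2)
  have in1: "(\<integral>y. v \<bullet> \<Phi> y \<partial>M) = v \<bullet> m" for v
    unfolding m_def by (rule integral_inner_right) (use I in auto)
  then show "(\<integral>y. \<Phi> x \<bullet> \<Phi> y \<partial>M) = \<Phi> x \<bullet> m" .
  have "u \<bullet> m = (\<integral>y. u \<bullet> \<Phi> y \<partial>M)" by (simp add: in1)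
  also have "\<dots> = (\<integral>y. 1 \<partial>M)"
    by (intro Bochner_Integration.integral_cong refl)
      (auto simp: probsD(3)[OF M] trace inner_commute[of u])
  finally have um: "u \<bullet> m = 1" by (simp add: prob_space)
  have "(\<integral>x. (\<integral>y. \<Phi> x \<bullet> \<Phi> y \<partial>M) \<partial>M) = (\<integral>x. m \<bullet> \<Phi> x \<partial>M)"
    by (simp add: in1 inner_commute)
  also have "\<dots> = m \<bullet> m" by (rule in1)
  also have "\<dots> = 1 / real (d + 1) + (norm (m - u /\<^sub>R real (d + 1)))\<^sup>2"
  proof -
    define D where "D = real (d + 1)"
    have uD: "u \<bullet> u = D" by (simp only: u_norm D_def)
    have "(norm (m - u /\<^sub>R D))\<^sup>2 = m \<bullet> m - 2 / D + D / (D * D)"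
      by (simp add: power2_norm_eq_inner inner_simps um inner_commute[of m u] uD
          divide_inverse algebra_simps)
    also have "D / (D * D) = 1 / D" by simp
    finally show ?thesis unfolding D_def[symmetric] by simp
  qed
  finally show "(\<integral>x. (\<integral>y. \<Phi> x \<bullet> \<Phi> y \<partial>M) \<partial>M) =
    1 / real (d + 1) + (norm (m - u /\<^sub>R real (d + 1)))\<^sup>2" .
qed

lemma mean_kernel_complement:
  assumes M: "M \<in> probs"
  shows "(\<integral>x. (\<integral>y. 1 - \<Phi> x \<bullet> \<Phi> y \<partial>M) \<partial>M) = 1 - (\<integral>x. (\<integral>y. \<Phi> x \<bullet> \<Phi> y \<partial>M) \<partial>M)"
proof -
  interpret prob_space M by (rule probsD[OF M])
  have [measurable]: "\<Phi> \<in> borel_measurable M" by (rule probsD[OF M])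
  have I: "integrable M \<Phi>"
    by (rule integrable_const_bound[of _ 1]) (auto simp: probsD(3)[OF M] norm_eq_sqrt_inner unit intro!: AE_I2)
  have "(\<integral>y. 1 - v \<bullet> \<Phi> y \<partial>M) = 1 - v \<bullet> (\<integral>y. \<Phi> y \<partial>M)"
    and "(\<integral>y. v \<bullet> \<Phi> y \<partial>M) = v \<bullet> (\<integral>y. \<Phi> y \<partial>M)" for v
    using I by (auto simp: prob_space)
  then show ?thesis using I by (simp add: prob_space)
qed

text \<open>
  The powers \<open>a\<^sup>q < a\<^sup>p\<close> of a number in \<open>(0, 1)\<close> differ strictly, so equality of the means
  confines \<open>\<theta> / \<pi>\<close> to \<open>{0, 1}\<close>, that is, the kernel to \<open>{1, 0}\<close>.
\<close>

lemma mean_power_mono: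
  assumes M: "M \<in> probs" and p: "0 < p" "p < q"
  shows "mean_power q M \<le> mean_power p M"
    and "mean_power q M = mean_power p M \<Longrightarrow>
      AE x in M. AE y in M. \<Phi> x \<bullet> \<Phi> y \<in> {0, 1}"
proof -
  interpret prob_space M by (rule probsD[OF M])
  note mono = iterated_integral_mono[OF angle_power_measurable[OF M, of q] angle_power_measurable[OF M, of p],
      simplified, unfolded probsD(3)[OF M]]
  note b = angle_power_antimono angle_power_bounds kernel_bounds
  show "mean_power q M \<le> mean_power p M"
    unfolding mean_power_def using p by (intro mono) (auto intro!: b)
  assume "mean_power q M = mean_power p M"
  then have ae: "AE x in M. AE y in M. angle_power q (\<Phi> x \<bullet> \<Phi> y) = angle_power p (\<Phi> x \<bullet> \<Phi> y)"
    unfolding mean_power_def using p by (intro mono) (auto intro!: b)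
  have D: "\<Phi> x \<bullet> \<Phi> y \<in> {0, 1}"
    if "x \<in> X" "y \<in> X" "angle_power q (\<Phi> x \<bullet> \<Phi> y) = angle_power p (\<Phi> x \<bullet> \<Phi> y)" for x y
    using angle_power_eqD[OF kernel_bounds[OF that(1,2)] p(2) that(3)] by auto
  have inX: "AE x in M. x \<in> X" using AE_space[of M] by (simp add: probsD(3)[OF M])
  from inX ae show "AE x in M. AE y in M. \<Phi> x \<bullet> \<Phi> y \<in> {0, 1}"
  proof eventually_elim
    case (elim x)
    from inX elim(2) show ?case by eventually_elim (rule D[OF elim(1)])
  qed
qed

text \<open>
  The exponents for which no measure beats an orthonormal basis, whose value is
  \<open>d / (d + 1)\<close> by lemma \<open>onb_mean_power\<close> below.
\<close>

definition onb_exponents :: "real set" where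
  "onb_exponents = {p. 0 < p \<and> (\<forall>M\<in>probs. mean_power p M \<le> real d / real (d + 1))}"

lemma two_onb_exponent: "2 \<in> onb_exponents"
proof -
  have "mean_power 2 M \<le> real d / real (d + 1)" if M: "M \<in> probs" for M
  proof -
    interpret prob_space M by (rule probsD[OF M])
    have m1: "(\<lambda>(x, y). 1 - \<Phi> x \<bullet> \<Phi> y) \<in> borel_measurable (M \<Otimes>\<^sub>M M)"
      using kernel_measurable[OF M] by (simp add: case_prod_beta')
    have "mean_power 2 M \<le> (\<integral>x. (\<integral>y. 1 - \<Phi> x \<bullet> \<Phi> y \<partial>M) \<partial>M)"
      unfolding mean_power_def
      using iterated_integral_mono(1)[OF angle_power_measurable[OF M, of 2] m1]
      by (simp add: probsD(3)[OF M] angle_power_2_le angle_power_bounds kernel_bounds)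
    also have "\<dots> = 1 - (\<integral>x. (\<integral>y. \<Phi> x \<bullet> \<Phi> y \<partial>M) \<partial>M)"
      by (rule mean_kernel_complement[OF M])
    also have "\<dots> \<le> 1 - 1 / real (d + 1)"
      unfolding mean_kernel(2)[OF M] by simp
    also have "\<dots> = real d / real (d + 1)" by (simp add: field_simps)
    finally show ?thesis .
  qed
  then show ?thesis by (simp add: onb_exponents_def)
qed

subsection \<open>The equality case\<close>

text \<open>
  Fix a point \<open>x\<close> whose kernel with almost every other point is \<open>0\<close> or \<open>1\<close>.  Then
  \<open>\<Phi> x \<bullet> \<Phi> y\<close> is almost surely the indicator of the fibre of \<open>\<Phi>\<close> through \<open>x\<close>,
  and integrating over \<open>y\<close> gives that fibre the mass \<open>\<Phi> x \<bullet> u / (d + 1) = 1 / (d + 1)\<close>.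
  Almost every \<open>x\<close> is of this kind, so there are exactly \<open>d + 1\<close> such fibres and they carry the
  whole measure.
\<close>

lemma onb_if_kernel_01:
  assumes M: "M \<in> probs"
    and ae: "AE x in M. AE y in M. \<Phi> x \<bullet> \<Phi> y \<in> {0, 1}"
    and m: "(\<integral>x. \<Phi> x \<partial>M) = u /\<^sub>R real (d + 1)"
  shows "is_onb_measure X \<theta> d M"
proof -
  interpret prob_space M by (rule probsD[OF M])
  note [simp] = probsD(3)[OF M]
  have [measurable]: "\<Phi> \<in> borel_measurable M" by (rule probsD[OF M])
  define good where "good x \<longleftrightarrow> x \<in> X \<and> (AE y in M. \<Phi> x \<bullet> \<Phi> y \<in> {0, 1})" for x
  have ae_good: "AE x in M. good x"
    using ae AE_space[of M] by eventually_elim (simp add: good_def)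
  define C where "C v = \<Phi> -` {v} \<inter> X" for v
  have C_sets [measurable]: "C v \<in> sets M" for v
    using measurable_sets[of \<Phi> M borel "{v}"] by (simp add: C_def)
  have mass: "prob (C (\<Phi> x)) = 1 / real (d + 1)" if x: "good x" for x
  proof -
    have "prob (C (\<Phi> x)) = (\<integral>y. indicator (C (\<Phi> x)) y \<partial>M)"
      using Int_absorb2[OF sets.sets_into_space[OF C_sets]] by simp
    also have "\<dots> = (\<integral>y. \<Phi> x \<bullet> \<Phi> y \<partial>M)"
    proof (rule integral_cong_AE)
      have "AE y in M. \<Phi> x \<bullet> \<Phi> y \<in> {0, 1}" "AE y in M. y \<in> X"
        using x AE_space[of M] by (auto simp: good_def)
      then show "AE y in M. indicator (C (\<Phi> x)) y = \<Phi> x \<bullet> \<Phi> y"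
      proof eventually_elim
        case (elim y)
        have "x \<in> X" using x by (simp add: good_def)
        from kernel_eq_1_iff[OF this elim(2)]
        have "y \<in> C (\<Phi> x) \<longleftrightarrow> \<Phi> x \<bullet> \<Phi> y = 1"
          using elim(2) unfolding C_def by (simp only: vimage_eq Int_iff singleton_iff) metis
        with elim(1) show ?case by (cases "\<Phi> x \<bullet> \<Phi> y = 1") (simp_all add: indicator_def)
      qed
    qed measurable
    also have "\<dots> = \<Phi> x \<bullet> (u /\<^sub>R real (d + 1))"
      using mean_kernel(1)[OF M] x by (simp add: good_def m)
    also have "\<dots> = 1 / real (d + 1)"
      using x by (simp add: good_def trace divide_inverse)
    finally show ?thesis .
  qed
  define V where "V = \<Phi> ` {x. good x}"
  have massV: "prob (C v) = 1 / real (d + 1)" if "v \<in> V" for v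
    using that mass by (auto simp: V_def)
  have disj: "disjoint_family_on C W" for W
    by (auto simp: disjoint_family_on_def C_def)
  have union: "prob (\<Union>v\<in>W. C v) = card W / real (d + 1)" if "finite W" "W \<subseteq> V" for W
  proof -
    have "prob (\<Union>v\<in>W. C v) = (\<Sum>v\<in>W. prob (C v))"
      using that by (intro finite_measure_finite_Union disj) auto
    also have "\<dots> = (\<Sum>v\<in>W. 1 / real (d + 1))"
      using that massV by (intro sum.cong refl) blast
    also have "\<dots> = card W / real (d + 1)" by simp
    finally show ?thesis .
  qed
  \<comment> \<open>disjoint sets of mass \<open>1 / (d + 1)\<close>: at most \<open>d + 1\<close> of them fit\<close>
  have "card W \<le> d + 1" if "finite W" "W \<subseteq> V" for W
  proof -
    have "card W / real (d + 1) \<le> 1" using union[OF that] prob_le_1 by metis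
    then have "real (card W) \<le> real (d + 1)" by (simp add: field_simps)
    then show ?thesis by linarith
  qed
  then have V: "finite V" using finite_if_finite_subsets_card_bdd[of V "d + 1"] by blast
  have full: "AE x in M. x \<in> (\<Union>v\<in>V. C v)"
    using ae_good by eventually_elim (auto simp: V_def C_def good_def)
  have "prob (\<Union>v\<in>V. C v) = 1"
    using V full by (subst prob_eq_1) auto
  with union[OF V] have cardV: "card V = d + 1" by (simp add: field_simps)
  obtain f where f: "bij_betw f {1..d+1} V"
    using finite_same_card_bij[of "{1..d+1}" V] V cardV by auto
  have "\<forall>v\<in>V. \<exists>x. good x \<and> \<Phi> x = v" by (auto simp: V_def)
  then obtain r where r: "\<And>v. v \<in> V \<Longrightarrow> good (r v) \<and> \<Phi> (r v) = v" by metis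
  define e where "e j = r (f j)" for j
  have fV: "f j \<in> V" if "j \<in> {1..d+1}" for j using f that by (auto simp: bij_betw_def)
  have eX: "e j \<in> X" and e_good: "good (e j)" and e_\<Phi>: "\<Phi> (e j) = f j" if "j \<in> {1..d+1}" for j
    using r[OF fV[OF that]] by (auto simp: e_def good_def)
  show ?thesis
    unfolding is_onb_measure_def
  proof (intro conjI M exI[of _ e] ballI impI)
    fix i assume "i \<in> {1..d+1}" then show "e i \<in> X" by (rule eX)
  next
    fix i j assume ij: "i \<in> {1..d+1}" "j \<in> {1..d+1}" "i \<noteq> j"
    have ne: "\<Phi> (e i) \<noteq> \<Phi> (e j)"
      using f ij by (auto simp: e_\<Phi> bij_betw_def inj_on_def)
    \<comment> \<open>the kernel condition holds only almost surely, but the fibre through \<open>e j\<close> has positive mass\<close>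
    have "\<exists>y\<in>C (\<Phi> (e j)). \<Phi> (e i) \<bullet> \<Phi> y \<in> {0, 1}"
    proof (rule ccontr)
      assume no: "\<not> ?thesis"
      have "AE y in M. \<Phi> (e i) \<bullet> \<Phi> y \<in> {0, 1}" using e_good[OF ij(1)] by (simp add: good_def)
      then have "AE y in M. y \<notin> C (\<Phi> (e j))" by eventually_elim (use no in blast)
      then have "prob (C (\<Phi> (e j))) = 0" by (subst prob_eq_0) auto
      with mass[OF e_good[OF ij(2)]] show False by simp
    qed
    then have "\<Phi> (e i) \<bullet> \<Phi> (e j) \<in> {0, 1}" by (auto simp: C_def)
    then have "\<Phi> (e i) \<bullet> \<Phi> (e j) = 0" using kernel_eq_1_iff[of "e i" "e j"] ne eX ij by auto
    then show "\<theta> (e i) (e j) = pi" using \<theta>_eq_pi_iff eX ij by simp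
  next
    fix A assume A: "A \<in> sets M"
    then obtain B where B: "A = \<Phi> -` B \<inter> X" using probsD(2)[OF M] by (auto simp: sets_borel_X)
    have "prob A = prob (\<Union>j\<in>{1..d+1}. A \<inter> C (f j))"
    proof (rule finite_measure_eq_AE)
      show "AE x in M. (x \<in> A) = (x \<in> (\<Union>j\<in>{1..d+1}. A \<inter> C (f j)))"
        using full by eventually_elim (use f in \<open>auto simp: bij_betw_def\<close>)
    qed (use A in auto)
    also have "\<dots> = (\<Sum>j\<in>{1..d+1}. prob (A \<inter> C (f j)))"
    proof (rule finite_measure_finite_Union)
      show "(\<lambda>j. A \<inter> C (f j)) ` {1..d+1} \<subseteq> sets M" using A by auto
      show "disjoint_family_on (\<lambda>j. A \<inter> C (f j)) {1..d+1}"
        using f by (auto simp: disjoint_family_on_def C_def bij_betw_def inj_on_def)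
    qed simp
    also have "\<dots> = (\<Sum>j\<in>{1..d+1}. 1 / real (d + 1) * measure (return M (e j)) A)"
    proof (rule sum.cong[OF refl])
      fix j assume j: "j \<in> {1..d+1}"
      \<comment> \<open>Borel sets do not split fibres\<close>
      have "A \<inter> C (f j) = (if e j \<in> A then C (f j) else {})"
        using eX[OF j] e_\<Phi>[OF j] by (auto simp: B C_def)
      then show "prob (A \<inter> C (f j)) = 1 / real (d + 1) * measure (return M (e j)) A"
        using A massV[OF fV[OF j]] by (auto simp: measure_return indicator_def)
    qed
    finally show "prob A = 1 / real (d + 1) * (\<Sum>j\<in>{1..d+1}. measure (return M (e j)) A)"
      unfolding sum_distrib_left .
  qed
qed

text \<open>
  A maximizer for \<open>q\<close> is squeezed between its own value and the bound at the smaller exponent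
  \<open>p\<close>, so both means agree and the kernel is almost surely \<open>0\<close> or \<open>1\<close>.  On these values
  \<open>angle_power\<close> is \<open>1 - k\<close>, which determines the mean kernel and hence the mean projector.
\<close>

lemma onb_if_maximal:
  assumes M: "M \<in> probs" and p: "p \<in> onb_exponents" "p < q"
    and ge: "real d / real (d + 1) \<le> mean_power q M"
  shows "is_onb_measure X \<theta> d M"
proof -
  interpret prob_space M by (rule probsD[OF M])
  have "0 < p" "mean_power p M \<le> real d / real (d + 1)"
    using p M by (auto simp: onb_exponents_def)
  then have eq: "mean_power q M = real d / real (d + 1)" "mean_power q M = mean_power p M"
    using mean_power_mono(1)[OF M _ p(2)] ge by auto
  then have ae: "AE x in M. AE y in M. \<Phi> x \<bullet> \<Phi> y \<in> {0, 1}"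
    using mean_power_mono(2)[OF M \<open>0 < p\<close> p(2)] by simp
  have "mean_power q M = (\<integral>x. (\<integral>y. 1 - \<Phi> x \<bullet> \<Phi> y \<partial>M) \<partial>M)"
    unfolding mean_power_def
  proof (rule iterated_integral_cong_AE[of "\<lambda>(x, y). angle_power q (\<Phi> x \<bullet> \<Phi> y)"
        "\<lambda>(x, y). 1 - \<Phi> x \<bullet> \<Phi> y", simplified])
    show "(\<lambda>(x, y). angle_power q (\<Phi> x \<bullet> \<Phi> y)) \<in> borel_measurable (M \<Otimes>\<^sub>M M)"
      using \<open>0 < p\<close> p(2) by (intro angle_power_measurable M) simp
    show "(\<lambda>(x, y). 1 - \<Phi> x \<bullet> \<Phi> y) \<in> borel_measurable (M \<Otimes>\<^sub>M M)"
      using kernel_measurable[OF M] by (simp add: case_prod_beta')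
    show "AE x in M. AE y in M. angle_power q (\<Phi> x \<bullet> \<Phi> y) = 1 - \<Phi> x \<bullet> \<Phi> y"
      using ae by eventually_elim (erule eventually_mono, auto)
  qed
  also have "\<dots> = 1 - (\<integral>x. (\<integral>y. \<Phi> x \<bullet> \<Phi> y \<partial>M) \<partial>M)"
    by (rule mean_kernel_complement[OF M])
  finally have "(norm ((\<integral>x. \<Phi> x \<partial>M) - u /\<^sub>R real (d + 1)))\<^sup>2 = 1 - 1 / real (d + 1) - real d / real (d + 1)"
    unfolding mean_kernel(2)[OF M] eq(1) by linarith
  also have "\<dots> = 0" by (simp add: field_simps)
  finally show ?thesis by (intro onb_if_kernel_01[OF M ae]) simp
qed

subsection \<open>Finitely supported measures\<close>

text \<open>
  The normalized counting measure of an indexed family, with multiplicity: repeated indices add up, so averages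
  of two bases are of this form.
\<close>

definition uniform_on :: "'i set \<Rightarrow> ('i \<Rightarrow> 'p) \<Rightarrow> 'p measure" where
  "uniform_on I g = distr (measure_pmf (pmf_of_set I)) borel_X g"

lemma uniform_on_probs:
  assumes g: "\<And>i. g i \<in> X"
  shows "uniform_on I g \<in> probs"
  unfolding probs_iff uniform_on_def
  using g by (auto intro!: measure_pmf.prob_space_distr)

lemma integral_uniform_on:
  fixes F :: "'p \<Rightarrow> real"
  assumes g: "\<And>i. g i \<in> X" and I: "finite I" "I \<noteq> {}" and F: "F \<in> borel_measurable borel_X"
  shows "(\<integral>x. F x \<partial>uniform_on I g) = (\<Sum>i\<in>I. F (g i)) / real (card I)"
  unfolding uniform_on_def using g I F
  by (subst integral_distr) (auto simp: integral_pmf_of_set)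

lemma measure_uniform_on:
  assumes g: "\<And>i. g i \<in> X" and I: "finite I" "I \<noteq> {}" and A: "A \<in> sets borel_X"
  shows "measure (uniform_on I g) A = (\<Sum>i\<in>I. indicator A (g i)) / real (card I)"
proof -
  have "A \<subseteq> X" using sets.sets_into_space[OF A] by simp
  then have "measure (uniform_on I g) A = (\<integral>x. indicator A x \<partial>uniform_on I g)"
    by (simp add: probsD(3)[OF uniform_on_probs[of g I, OF g]] Int_absorb2)
  also have "\<dots> = (\<Sum>i\<in>I. indicator A (g i)) / real (card I)"
    using A by (intro integral_uniform_on g I) simp
  finally show ?thesis .
qed

lemma mean_power_uniform_on:
  assumes g: "\<And>i. g i \<in> X" and I: "finite I" "I \<noteq> {}" and p: "0 < p"
  shows "mean_power p (uniform_on I g) =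
    (\<Sum>i\<in>I. \<Sum>j\<in>I. angle_power p (\<Phi> (g i) \<bullet> \<Phi> (g j))) / (real (card I))\<^sup>2"
proof -
  let ?M = "uniform_on I g"
  have M: "?M \<in> probs" using g by (rule uniform_on_probs)
  interpret prob_space ?M by (rule probsD[OF M])
  have sets: "sets ?M = sets borel_X" by (rule probsD[OF M])
  have meas: "measurable ?M borel = measurable borel_X (borel :: real measure)"
    by (rule measurable_cong_sets) (simp_all add: sets)
  note k = angle_power_measurable[OF M p]
  have "(\<lambda>y. angle_power p (\<Phi> x \<bullet> \<Phi> y)) \<in> borel_measurable borel_X" if "x \<in> X" for x
    using measurable_Pair2[OF k, of x] that by (simp add: probsD(3)[OF M] meas)
  then have inner: "(\<integral>y. angle_power p (\<Phi> x \<bullet> \<Phi> y) \<partial>?M)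
      = (\<Sum>j\<in>I. angle_power p (\<Phi> x \<bullet> \<Phi> (g j))) / real (card I)" if "x \<in> X" for x
    using that by (intro integral_uniform_on g I)
  have "(\<lambda>x. \<integral>y. angle_power p (\<Phi> x \<bullet> \<Phi> y) \<partial>?M) \<in> borel_measurable borel_X"
    using borel_measurable_lebesgue_integral[of "\<lambda>x y. angle_power p (\<Phi> x \<bullet> \<Phi> y)" ?M] k
    by (simp add: meas)
  from integral_uniform_on[OF g I this]
  show ?thesis
    unfolding mean_power_def using g
    by (simp add: inner power2_eq_square sum_divide_distrib[symmetric])
qed

lemma onb_measure_eq_uniform_on:
  assumes "is_onb_measure X \<theta> d M"
  obtains e where "\<And>i. e i \<in> X" "M = uniform_on {1..d+1} e"
    "\<And>i j. i \<in> {1..d+1} \<Longrightarrow> j \<in> {1..d+1} \<Longrightarrow> i \<noteq> j \<Longrightarrow> \<Phi> (e i) \<bullet> \<Phi> (e j) = 0"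
proof -
  from assms obtain e' where M: "M \<in> probs"
    and e': "\<And>i. i \<in> {1..d+1} \<Longrightarrow> e' i \<in> X"
      "\<And>i j. i \<in> {1..d+1} \<Longrightarrow> j \<in> {1..d+1} \<Longrightarrow> i \<noteq> j \<Longrightarrow> \<theta> (e' i) (e' j) = pi"
    and eq: "\<And>A. A \<in> sets M \<Longrightarrow> measure M A = 1 / real (d + 1) * (\<Sum>j\<in>{1..d+1}. measure (return M (e' j)) A)"
    unfolding is_onb_measure_def by blast
  \<comment> \<open>indices outside the range may point outside \<open>X\<close>; any point of \<open>X\<close> will do for them\<close>
  define e where "e i = (if i \<in> {1..d+1} then e' i else e' 1)" for i
  have eX: "e i \<in> X" for i using e'(1) by (simp add: e_def)
  let ?N = "uniform_on {1..d+1} e"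
  have N: "?N \<in> probs" using eX by (rule uniform_on_probs)
  interpret M: prob_space M by (rule probsD[OF M])
  interpret N: prob_space ?N by (rule probsD[OF N])
  have "M = ?N"
  proof (rule measure_eqI)
    show "sets M = sets ?N" using probsD(2)[OF M] probsD(2)[OF N] by simp
    fix A assume A: "A \<in> sets M"
    then have A': "A \<in> sets borel_X" using probsD(2)[OF M] by simp
    have "measure ?N A = (\<Sum>j\<in>{1..d+1}. indicator A (e j)) / real (card {1..d+1})"
      by (rule measure_uniform_on[OF eX _ _ A']) auto
    also have "(\<Sum>j\<in>{1..d+1}. indicator A (e j)) = (\<Sum>j\<in>{1..d+1}. indicator A (e' j) :: real)"
      by (intro sum.cong refl) (simp add: e_def)
    also have "(\<Sum>j\<in>{1..d+1}. indicator A (e' j) :: real) = (\<Sum>j\<in>{1..d+1}. measure (return M (e' j)) A)"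
      using A by (intro sum.cong refl) (auto simp: measure_return)
    finally have "measure M A = measure ?N A" unfolding eq[OF A] by simp
    then show "emeasure M A = emeasure ?N A"
      unfolding M.emeasure_eq_measure N.emeasure_eq_measure by simp
  qed
  moreover have "\<Phi> (e i) \<bullet> \<Phi> (e j) = 0" if "i \<in> {1..d+1}" "j \<in> {1..d+1}" "i \<noteq> j" for i j
    using that e' \<theta>_eq_pi_iff by (auto simp: e_def)
  ultimately show ?thesis using eX that by blast
qed

lemma sum_off_diagonal:
  assumes "i \<in> {1..d+1}"
  shows "(\<Sum>j\<in>{1..d+1}. if j = i then 0 else 1) = real d"
proof -
  have "(\<Sum>j\<in>{1..d+1}. if j = i then 0 else 1) = (\<Sum>j\<in>{1..d+1}. 1 - (if j = i then 1 else 0 :: real))"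
    by (intro sum.cong refl) simp
  also have "\<dots> = (\<Sum>j\<in>{1..d+1}. 1) - 1"
    unfolding sum_subtractf sum.delta[OF finite_atLeastAtMost] using assms by simp
  finally show ?thesis by simp
qed

lemma onb_mean_power:
  assumes "is_onb_measure X \<theta> d M" "0 < p"
  shows "mean_power p M = real d / real (d + 1)"
proof -
  from onb_measure_eq_uniform_on[OF assms(1)] obtain e where
    e: "\<And>i. e i \<in> X" "M = uniform_on {1..d+1} e"
    "\<And>i j. i \<in> {1..d+1} \<Longrightarrow> j \<in> {1..d+1} \<Longrightarrow> i \<noteq> j \<Longrightarrow> \<Phi> (e i) \<bullet> \<Phi> (e j) = 0" by blast
  have "(\<Sum>i\<in>{1..d+1}. \<Sum>j\<in>{1..d+1}. angle_power p (\<Phi> (e i) \<bullet> \<Phi> (e j)))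
      = (\<Sum>i\<in>{1..d+1}. \<Sum>j\<in>{1..d+1}. if j = i then 0 else 1)"
    using e(3) by (intro sum.cong refl) (auto simp: unit e(1))
  also have "\<dots> = (\<Sum>i\<in>{1..d+1}. real d)"
    by (intro sum.cong refl sum_off_diagonal)
  also have "\<dots> = real (d + 1) * real d" by simp
  finally show ?thesis
    unfolding e(2) using mean_power_uniform_on[OF e(1) _ _ assms(2), of "{1..d+1}"]
    by (simp add: power2_eq_square)
qed

text \<open>
  Two orthonormal bases that share all but the first two vectors, the plane of which is turned by
  half a right angle.
\<close>

lemma rotated_bases_exist:
  "\<exists>a b :: nat \<Rightarrow> real ^ 'n. (\<forall>i. norm (a i) = 1) \<and> (\<forall>i. norm (b i) = 1) \<and>
    (\<forall>i\<in>{1..d+1}. \<forall>j\<in>{1..d+1}. a i \<bullet> a j = (if i = j then 1 else 0)) \<and>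
    (\<forall>i\<in>{1..d+1}. \<forall>j\<in>{1..d+1}. b i \<bullet> b j = (if i = j then 1 else 0)) \<and>
    (\<forall>i\<in>{1..d+1}. \<forall>j\<in>{1..d+1}.
      (a i \<bullet> b j)\<^sup>2 = (if i \<in> {1, 2} \<and> j \<in> {1, 2} then 1 / 2 else if i = j then 1 else 0))"
proof -
  obtain f :: "nat \<Rightarrow> 'n" where f: "bij_betw f {1..d+1} UNIV"
    using finite_same_card_bij[of "{1..d+1}" "UNIV :: 'n set"] dim by auto
  define a where "a i = axis (f i) (1::real)" for i
  define b where "b i = (if i = 1 then (1 / sqrt 2) *\<^sub>R (a 1 + a 2)
    else if i = 2 then (1 / sqrt 2) *\<^sub>R (a 1 - a 2) else a i)" for i
  have a: "a i \<bullet> a j = (if i = j then 1 else 0)" if "i \<in> {1..d+1}" "j \<in> {1..d+1}" for i j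
    using f that by (auto simp: a_def inner_axis_axis bij_betw_def inj_on_def)
  have a1: "norm (a i) = 1" for i by (simp add: a_def norm_eq_1 inner_axis_axis)
  have a12: "a (Suc 0) \<bullet> a 2 = 0" "a 2 \<bullet> a (Suc 0) = 0" using a[of 1 2] a[of 2 1] dim(2) by auto
  have aa: "a i \<bullet> a i = 1" for i using a1[of i] by (simp add: norm_eq_1)
  have b1: "norm (b i) = 1" for i
    by (simp add: norm_eq_1 b_def inner_simps aa a12)
  have bb: "b i \<bullet> b j = (if i = j then 1 else 0)" if "i \<in> {1..d+1}" "j \<in> {1..d+1}" for i j
    using that dim(2) by (auto simp: b_def inner_simps a)
  have ab: "(a i \<bullet> b j)\<^sup>2 = (if i \<in> {1, 2} \<and> j \<in> {1, 2} then 1 / 2 else if i = j then 1 else 0)"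
    if "i \<in> {1..d+1}" "j \<in> {1..d+1}" for i j
    using that dim(2) by (auto simp: b_def inner_simps a power_divide)
  show ?thesis
    by (rule exI[of _ a], rule exI[of _ b], intro conjI allI ballI) (fact a1 b1 a bb ab)+
qed

lemma onb_exists: "\<exists>M. is_onb_measure X \<theta> d M"
proof -
  obtain a :: "nat \<Rightarrow> real ^ 'n" where a: "\<forall>i. norm (a i) = 1"
    and aa: "\<forall>i\<in>{1..d+1}. \<forall>j\<in>{1..d+1}. a i \<bullet> a j = (if i = j then 1 else 0)"
    using rotated_bases_exist by blast
  define e where "e i = pt (a i)" for i
  have eX: "e i \<in> X" for i by (simp add: e_def pt_in a)
  let ?N = "uniform_on {1..d+1} e"
  have N: "?N \<in> probs" using eX by (rule uniform_on_probs)
  have "is_onb_measure X \<theta> d ?N"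
    unfolding is_onb_measure_def
  proof (intro conjI N exI[of _ e] ballI impI eX)
    fix i j assume "i \<in> {1..d+1}" "j \<in> {1..d+1}" "i \<noteq> j"
    then show "\<theta> (e i) (e j) = pi"
      using \<theta>_eq_pi_iff[OF eX eX] by (simp add: e_def pt_kernel a aa)
  next
    fix A assume A: "A \<in> sets ?N"
    then have A': "A \<in> sets borel_X" using probsD(2)[OF N] by simp
    have "measure ?N A = (\<Sum>j\<in>{1..d+1}. indicator A (e j)) / real (card {1..d+1})"
      by (rule measure_uniform_on[OF eX _ _ A']) auto
    also have "(\<Sum>j\<in>{1..d+1}. indicator A (e j) :: real) = (\<Sum>j\<in>{1..d+1}. measure (return ?N (e j)) A)"
      using A by (intro sum.cong refl) (auto simp: measure_return)
    finally show "measure ?N A = 1 / real (d + 1) * (\<Sum>j\<in>{1..d+1}. measure (return ?N (e j)) A)"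
      by simp
  qed
  then show ?thesis by blast
qed

subsection \<open>The threshold\<close>

text \<open>
  In the average of the two bases, the pairs within one basis contribute as for a single basis.  Among
  the pairs across the bases, the four formed from the first two vectors of each have
  \<open>\<theta> = \<pi> / 2\<close> instead of twice \<open>0\<close> and twice \<open>\<pi>\<close>; they contribute
  \<open>4 (1 / 2)\<^sup>p\<close> instead of \<open>2\<close>, which is more for \<open>p < 1\<close>.
\<close>

lemma onb_exponents_ge_1:
  assumes "p \<in> onb_exponents"
  shows "1 \<le> p"
proof (rule ccontr)
  assume "\<not> 1 \<le> p"
  then have p: "0 < p" "p < 1" using assms by (auto simp: onb_exponents_def)
  obtain a b :: "nat \<Rightarrow> real ^ 'n" where ab: "\<forall>i. norm (a i) = 1" "\<forall>i. norm (b i) = 1"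
    and aa: "\<forall>i\<in>{1..d+1}. \<forall>j\<in>{1..d+1}. a i \<bullet> a j = (if i = j then 1 else 0)"
    and bb: "\<forall>i\<in>{1..d+1}. \<forall>j\<in>{1..d+1}. b i \<bullet> b j = (if i = j then 1 else 0)"
    and mix: "\<forall>i\<in>{1..d+1}. \<forall>j\<in>{1..d+1}.
      (a i \<bullet> b j)\<^sup>2 = (if i \<in> {1, 2} \<and> j \<in> {1, 2} then 1 / 2 else if i = j then 1 else 0)"
    using rotated_bases_exist by blast
  define I where "I = {1..d+1} \<times> (UNIV :: bool set)"
  define g where "g = (\<lambda>(i, c). pt (if c then a i else b i))"
  have gX: "g i \<in> X" for i by (auto simp: g_def pt_in ab split: prod.split)
  have I: "finite I" "I \<noteq> {}" "card I = 2 * (d + 1)" by (auto simp: I_def)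
  \<comment> \<open>the excess of a pair across the bases over the same pair within one basis\<close>
  define c where "c i j = (if i \<in> {1,2} \<and> j \<in> {1,2} then (1/2) powr p - (if j = i then 0 else 1) else 0)"
    for i j :: nat
  have k: "angle_power p (\<Phi> (g (i, True)) \<bullet> \<Phi> (g (j, True))) = (if j = i then 0 else 1)"
    "angle_power p (\<Phi> (g (i, False)) \<bullet> \<Phi> (g (j, False))) = (if j = i then 0 else 1)"
    "angle_power p (\<Phi> (g (i, True)) \<bullet> \<Phi> (g (j, False))) = (if j = i then 0 else 1) + c i j"
    "angle_power p (\<Phi> (g (i, False)) \<bullet> \<Phi> (g (j, True))) = (if j = i then 0 else 1) + c i j"
    if "i \<in> {1..d+1}" "j \<in> {1..d+1}" for i j
  proof -
    show "angle_power p (\<Phi> (g (i, True)) \<bullet> \<Phi> (g (j, True))) = (if j = i then 0 else 1)"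
      using aa[rule_format, OF that] by (simp add: g_def pt_kernel ab)
    show "angle_power p (\<Phi> (g (i, False)) \<bullet> \<Phi> (g (j, False))) = (if j = i then 0 else 1)"
      using bb[rule_format, OF that] by (simp add: g_def pt_kernel ab)
    show "angle_power p (\<Phi> (g (i, True)) \<bullet> \<Phi> (g (j, False))) = (if j = i then 0 else 1) + c i j"
      by (simp add: g_def pt_kernel ab mix[rule_format, OF that] c_def)
    have "angle_power p (\<Phi> (g (i, False)) \<bullet> \<Phi> (g (j, True)))
        = angle_power p (if j \<in> {1, 2} \<and> i \<in> {1, 2} then 1 / 2 else if j = i then 1 else 0)"
      using mix[rule_format, OF that(2,1)] by (simp add: g_def pt_kernel ab inner_commute[of "b i"])
    then show "angle_power p (\<Phi> (g (i, False)) \<bullet> \<Phi> (g (j, True))) = (if j = i then 0 else 1) + c i j"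
      by (simp add: c_def)
  qed
  have split: "(\<Sum>z\<in>I. G z) = (\<Sum>i\<in>{1..d+1}. G (i, True) + G (i, False))" for G :: "nat \<times> bool \<Rightarrow> real"
    unfolding I_def sum.cartesian_product' by (simp only: UNIV_bool) (simp add: add.commute)
  have "(\<Sum>z\<in>I. \<Sum>w\<in>I. angle_power p (\<Phi> (g z) \<bullet> \<Phi> (g w)))
    = (\<Sum>i\<in>{1..d+1}. \<Sum>j\<in>{1..d+1}. 4 * (if j = i then 0 else 1) + 2 * c i j)"
    unfolding split sum.distrib[symmetric]
  proof (intro sum.cong refl)
    fix i j assume ij: "i \<in> {1..d+1}" "j \<in> {1..d+1}"
    show "angle_power p (\<Phi> (g (i, True)) \<bullet> \<Phi> (g (j, True))) +
        angle_power p (\<Phi> (g (i, True)) \<bullet> \<Phi> (g (j, False))) +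
        (angle_power p (\<Phi> (g (i, False)) \<bullet> \<Phi> (g (j, True))) +
         angle_power p (\<Phi> (g (i, False)) \<bullet> \<Phi> (g (j, False))))
      = 4 * (if j = i then 0 else 1) + 2 * c i j"
      unfolding k[OF ij] by simp
  qed
  also have "\<dots> = 4 * (\<Sum>i\<in>{1..d+1}. \<Sum>j\<in>{1..d+1}. if j = i then 0 else 1) + 2 * (\<Sum>i\<in>{1..d+1}. \<Sum>j\<in>{1..d+1}. c i j)"
    by (simp only: sum.distrib sum_distrib_left)
  also have "(\<Sum>i\<in>{1..d+1}. \<Sum>j\<in>{1..d+1}. if j = i then 0 else 1) = (\<Sum>i\<in>{1..d+1}. real d)"
    by (intro sum.cong refl sum_off_diagonal)
  also have "(\<Sum>i\<in>{1..d+1}. real d) = real (d + 1) * real d" by simp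
  also have "(\<Sum>i\<in>{1..d+1}. \<Sum>j\<in>{1..d+1}. c i j) = (\<Sum>i\<in>{1,2}. \<Sum>j\<in>{1,2}. c i j)"
  proof -
    have "(\<Sum>j\<in>{1..d+1}. c i j) = (\<Sum>j\<in>{1,2}. c i j)" for i
      using dim(2) by (intro sum.mono_neutral_right) (auto simp: c_def)
    moreover have "(\<Sum>i\<in>{1..d+1}. \<Sum>j\<in>{1,2}. c i j) = (\<Sum>i\<in>{1,2}. \<Sum>j\<in>{1,2}. c i j)"
      using dim(2) by (intro sum.mono_neutral_right) (auto simp: c_def)
    ultimately show ?thesis by simp
  qed
  also have "\<dots> = 4 * (1/2) powr p - 2" by (simp add: c_def)
  finally have sum: "(\<Sum>z\<in>I. \<Sum>w\<in>I. angle_power p (\<Phi> (g z) \<bullet> \<Phi> (g w)))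
    = 4 * (real (d + 1) * real d) + 2 * (4 * (1/2) powr p - 2)" .
  have "(1/2) powr 1 < (1/2 :: real) powr p" using p by (intro powr_less_mono') auto
  then have "4 * (real (d + 1) * real d)
      < (\<Sum>z\<in>I. \<Sum>w\<in>I. angle_power p (\<Phi> (g z) \<bullet> \<Phi> (g w)))"
    unfolding sum by simp
  then have "4 * (real (d + 1) * real d) / (real (card I))\<^sup>2 < mean_power p (uniform_on I g)"
    unfolding mean_power_uniform_on[OF gX I(1,2) p(1)] using I(3)
    by (intro divide_strict_right_mono) auto
  moreover have "4 * (real (d + 1) * real d) / (real (card I))\<^sup>2 = real d / real (d + 1)"
  proof -
    have "real (card I) = 2 * real (d + 1)" using I(3) by simp
    then show ?thesis by (simp only: power2_eq_square) (simp del: of_nat_add of_nat_Suc)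
  qed
  ultimately have "real d / real (d + 1) < mean_power p (uniform_on I g)" by simp
  moreover have "mean_power p (uniform_on I g) \<le> real d / real (d + 1)"
    using assms uniform_on_probs[of g I, OF gX] by (simp add: onb_exponents_def)
  ultimately show False by simp
qed

lemma unique_onb_threshold: "\<exists>!t. t \<in> {-2..-1} \<and> is_onb_threshold X \<theta> d t"
proof -
  define p0 where "p0 = Inf onb_exponents"
  have bdd: "bdd_below onb_exponents" using onb_exponents_ge_1 by (rule bdd_belowI)
  have p0: "1 \<le> p0" "p0 \<le> 2"
    unfolding p0_def using two_onb_exponent onb_exponents_ge_1 bdd
    by (auto intro!: cInf_greatest cInf_lower)
  obtain N where N: "is_onb_measure X \<theta> d N" using onb_exists by blast
  have NP: "N \<in> probs" using N by (simp add: is_onb_measure_def)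
  have threshold: "is_onb_threshold X \<theta> d (- p0)"
    unfolding is_onb_threshold_def
  proof (intro conjI allI impI)
    fix s M assume s: "s < - p0"
    then obtain p where p: "p \<in> onb_exponents" "p < - s"
      using cInf_lessD[of onb_exponents "- s"] two_onb_exponent by (auto simp: p0_def)
    have s0: "s < 0" using s p0 by simp
    have "0 < p" using p by (simp add: onb_exponents_def)
    have le: "mean_power (- s) L \<le> real d / real (d + 1)" if "L \<in> probs" for L
      using mean_power_mono(1)[OF that \<open>0 < p\<close> p(2)] p(1) that by (fastforce simp: onb_exponents_def)
    show "is_minimizer X \<theta> (F_pow s) M \<longleftrightarrow> is_onb_measure X \<theta> d M"
    proof
      assume M: "is_minimizer X \<theta> (F_pow s) M"
      then have MP: "M \<in> probs" and "energy \<theta> (F_pow s) M \<le> energy \<theta> (F_pow s) N"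
        using NP by (auto simp: is_minimizer_def)
      then have "mean_power (- s) N \<le> mean_power (- s) M"
        using energy_le_iff[OF MP NP s0] by simp
      then have "real d / real (d + 1) \<le> mean_power (- s) M"
        using onb_mean_power[OF N, of "- s"] s0 by simp
      then show "is_onb_measure X \<theta> d M" by (rule onb_if_maximal[OF MP p])
    next
      assume M: "is_onb_measure X \<theta> d M"
      then have MP: "M \<in> probs" by (simp add: is_onb_measure_def)
      show "is_minimizer X \<theta> (F_pow s) M"
        unfolding is_minimizer_def
      proof (intro conjI MP ballI)
        fix L assume L: "L \<in> probs"
        show "energy \<theta> (F_pow s) M \<le> energy \<theta> (F_pow s) L"
          unfolding energy_le_iff[OF MP L s0]
          using le[OF L] onb_mean_power[OF M, of "- s"] s0 by simp
      qed
    qed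
  next
    fix s M assume s: "- p0 < s \<and> s < 0" and M: "is_onb_measure X \<theta> d M"
    have MP: "M \<in> probs" using M by (simp add: is_onb_measure_def)
    have "- s \<notin> onb_exponents"
      using s cInf_lower[OF _ bdd, of "- s"] by (auto simp: p0_def)
    then obtain L where L: "L \<in> probs" "real d / real (d + 1) < mean_power (- s) L"
      using s by (auto simp: onb_exponents_def not_le)
    show "\<not> is_minimizer X \<theta> (F_pow s) M"
    proof
      assume "is_minimizer X \<theta> (F_pow s) M"
      then have "energy \<theta> (F_pow s) M \<le> energy \<theta> (F_pow s) L"
        using L(1) unfolding is_minimizer_def by blast
      then have "mean_power (- s) L \<le> mean_power (- s) M"
        using energy_le_iff[OF MP L(1)] s by simp
      then show False using L(2) onb_mean_power[OF M, of "- s"] s by simp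
    qed
  qed
  have unique: "\<not> t < t'" if "t \<in> {-2..-1}" "is_onb_threshold X \<theta> d t"
    "t' \<in> {-2..-1}" "is_onb_threshold X \<theta> d t'" for t t'
  proof
    assume "t < t'"
    \<comment> \<open>between two thresholds the basis measure \<open>N\<close> both is and is not a minimizer\<close>
    define s where "s = (t + t') / 2"
    have s: "t < s" "s < t'" "s < 0" using \<open>t < t'\<close> that by (auto simp: s_def)
    have "is_minimizer X \<theta> (F_pow s) N" using that(4) s N unfolding is_onb_threshold_def by blast
    moreover have "\<not> is_minimizer X \<theta> (F_pow s) N" using that(2) s N unfolding is_onb_threshold_def by blast
    ultimately show False by blast
  qed
  have p0': "- p0 \<in> {-2..-1}" using p0 by simp
  show ?thesis
  proof (intro ex1I[of _ "- p0"] conjI threshold p0')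
    fix t assume t: "t \<in> {-2..-1} \<and> is_onb_threshold X \<theta> d t"
    show "t = - p0"
      using unique[of t "- p0"] unique[of "- p0" t] t threshold p0' by (meson linorder_neqE)
  qed
qed

end

section \<open>The projector of a line\<close>

instantiation quat :: euclidean_space
begin

definition Basis_quat :: "quat set" where
  "Basis = {Quat 1 0 0 0, Quat 0 1 0 0, Quat 0 0 1 0, Quat 0 0 0 1}"

instance
proof
  show "(Basis :: quat set) \<noteq> {}" "finite (Basis :: quat set)"
    by (simp_all add: Basis_quat_def)
  fix u v x :: quat
  show "u \<bullet> v = (if u = v then 1 else 0)" if "u \<in> Basis" "v \<in> Basis"
    using that unfolding Basis_quat_def insert_iff empty_iff
    by (elim disjE) (simp_all add: inner_quat_def)
  show "(\<forall>u\<in>Basis. x \<bullet> u = 0) \<longleftrightarrow> x = 0"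
    by (cases x) (simp add: Basis_quat_def inner_quat_def zero_quat_def)
qed

end

lemma inner_mult_left_same:
  fixes a b c :: "'a::{real_normed_div_algebra, real_inner}"
  shows "(a * b) \<bullet> (a * c) = (norm a)\<^sup>2 * (b \<bullet> c)"
proof -
  have "(norm (a * (b + c)))\<^sup>2 = (norm a)\<^sup>2 * (norm (b + c))\<^sup>2"
    by (simp add: norm_mult power_mult_distrib)
  then have "(a * b + a * c) \<bullet> (a * b + a * c) = (norm a)\<^sup>2 * ((b + c) \<bullet> (b + c))"
    by (simp add: power2_norm_eq_inner distrib_left)
  moreover have "(a * x) \<bullet> (a * x) = (norm a)\<^sup>2 * (x \<bullet> x)" for x
    by (simp flip: power2_norm_eq_inner add: norm_mult power_mult_distrib)
  ultimately show ?thesis by (simp add: inner_simps inner_commute algebra_simps)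
qed

lemma inner_mult_right_same:
  fixes a b c :: "'a::{real_normed_div_algebra, real_inner}"
  shows "(b * a) \<bullet> (c * a) = (norm a)\<^sup>2 * (b \<bullet> c)"
proof -
  have "(norm ((b + c) * a))\<^sup>2 = (norm a)\<^sup>2 * (norm (b + c))\<^sup>2"
    by (simp add: norm_mult power_mult_distrib)
  then have "(b * a + c * a) \<bullet> (b * a + c * a) = (norm a)\<^sup>2 * ((b + c) \<bullet> (b + c))"
    by (simp add: power2_norm_eq_inner distrib_right)
  moreover have "(x * a) \<bullet> (x * a) = (norm a)\<^sup>2 * (x \<bullet> x)" for x
    by (simp flip: power2_norm_eq_inner add: norm_mult power_mult_distrib)
  ultimately show ?thesis by (simp add: inner_simps inner_commute algebra_simps)
qed

lemma fconj_mult_self: "fconj x * x = (norm x)\<^sup>2 *\<^sub>R (1 :: 'a::conj_div_algebra)"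
  using mult_fconj[of "fconj x"] by (simp add: fconj_fconj norm_fconj)

text \<open>
  Multiplication by \<open>a\<close> scales the inner product by \<open>\<bar>a\<bar>\<^sup>2\<close>, so its adjoint is its inverse up
  to that factor, which is multiplication by the conjugate.
\<close>

lemma inner_fconj_mult:
  fixes a b c :: "'a::{conj_div_algebra, real_inner}"
  shows "(fconj a * b) \<bullet> c = b \<bullet> (a * c)"
proof (cases "a = 0")
  case True
  then have "fconj a = 0" using norm_fconj[of a] by simp
  with True show ?thesis by simp
next
  case False
  have "(norm a)\<^sup>2 * ((fconj a * b) \<bullet> c) = (a * (fconj a * b)) \<bullet> (a * c)"
    by (simp add: inner_mult_left_same)
  also have "\<dots> = (norm a)\<^sup>2 * (b \<bullet> (a * c))"
    by (simp add: mult.assoc[symmetric] mult_fconj)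
  finally show ?thesis using False by simp
qed

lemma inner_mult_fconj:
  fixes a b c :: "'a::{conj_div_algebra, real_inner}"
  shows "(b * fconj a) \<bullet> c = b \<bullet> (c * a)"
proof (cases "a = 0")
  case True
  then have "fconj a = 0" using norm_fconj[of a] by simp
  with True show ?thesis by simp
next
  case False
  have "(norm a)\<^sup>2 * ((b * fconj a) \<bullet> c) = ((b * fconj a) * a) \<bullet> (c * a)"
    by (simp add: inner_mult_right_same)
  also have "\<dots> = (norm a)\<^sup>2 * (b \<bullet> (c * a))"
    by (simp add: mult.assoc fconj_mult_self)
  finally show ?thesis using False by simp
qed

lemma fconj_of_real: "fconj (of_real r) = (of_real r :: 'a::conj_div_algebra)"
proof (cases "r = 0")
  case True
  then show ?thesis using norm_fconj[of "0::'a"] by simp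
next
  case False
  have "of_real r * fconj (of_real r) = (of_real r * of_real r :: 'a)"
    by (simp add: mult_fconj power2_eq_square scaleR_conv_of_real)
  with False show ?thesis by simp
qed

text \<open>
  For a unit vector \<open>x\<close> of the line this matrix is \<open>x\<^sup>* x\<close>; replacing \<open>x\<close> by
  \<open>c x\<close> with \<open>\<bar>c\<bar> = 1\<close> does not change it, since the two factors meet in the middle and cancel.
\<close>

definition line_projector :: "('a::conj_div_algebra ^ 'n) set \<Rightarrow> 'a ^ 'n ^ 'n" where
  "line_projector L = (\<chi> i j. fconj (unit_rep L $ i) * unit_rep L $ j)"

lemma inner_line_projector:
  fixes L L' :: "('a::{conj_div_algebra, real_inner} ^ 'n) set"
  shows "line_projector L \<bullet> line_projector L' = (norm (herm (unit_rep L) (unit_rep L')))\<^sup>2"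
proof -
  let ?x = "unit_rep L" and ?y = "unit_rep L'"
  have "(fconj (?x $ i) * ?x $ j) \<bullet> (fconj (?y $ i) * ?y $ j)
      = (?x $ j * fconj (?y $ j)) \<bullet> (?x $ i * fconj (?y $ i))" for i j
    by (simp add: inner_fconj_mult inner_mult_fconj[of "?x $ j"] mult.assoc)
  then show ?thesis
    by (simp add: line_projector_def inner_vec_def herm_def power2_norm_eq_inner
        inner_sum_left inner_sum_right)
qed

lemma herm_self: "herm x x = (norm x)\<^sup>2 *\<^sub>R (1 :: 'a::conj_div_algebra)"
proof -
  have "(norm x)\<^sup>2 = (\<Sum>i\<in>UNIV. (norm (x $ i))\<^sup>2)"
    by (simp add: norm_vec_def L2_set_def sum_nonneg)
  then show ?thesis by (simp add: herm_def mult_fconj scaleR_left.sum)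
qed

text \<open>
  Dividing a spanning vector by its norm shows that the choice in \<open>unit_rep\<close> is from a nonempty set.
\<close>

lemma unit_rep_in:
  fixes L :: "('a::conj_div_algebra ^ 'n) set"
  assumes "L \<in> proj_space"
  shows "unit_rep L \<in> L" "norm (unit_rep L) = 1"
proof -
  obtain z where z: "z \<noteq> 0" "L = line z" using assms by (auto simp: proj_space_def)
  let ?x = "(of_real (inverse (norm z)) :: 'a) *s z"
  have "norm ?x = 1" using z by (simp only: norm_vector_scalar_mult) (simp add: norm_inverse)
  moreover have "?x \<in> L" by (auto simp: z line_def)
  ultimately have "\<exists>x. x \<in> L \<and> norm x = 1" by blast
  then have "unit_rep L \<in> L \<and> norm (unit_rep L) = 1"
    unfolding unit_rep_def by (rule someI_ex)
  then show "unit_rep L \<in> L" "norm (unit_rep L) = 1" by auto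
qed

definition real_line :: "real ^ 'n \<Rightarrow> ('a::conj_div_algebra ^ 'n) set" where
  "real_line v = line (\<chi> i. of_real (v $ i))"

lemma line_projector_embedding:
  assumes dim: "CARD('n::finite) = d + 1" "d \<ge> 1"
  shows "projector_embedding (proj_space :: ('a::{conj_div_algebra, euclidean_space} ^ 'n) set set)
    proj_dist line_projector (mat 1) real_line d"
proof
  show "CARD('n) = d + 1" "d \<ge> 1" by (fact dim)+
next
  fix L L' :: "('a ^ 'n) set" assume L: "L \<in> proj_space" and L': "L' \<in> proj_space"
  let ?x = "unit_rep L"
  show "line_projector L \<bullet> line_projector L = 1"
    using unit_rep_in[OF L] by (simp add: inner_line_projector herm_self)
  have "(fconj (?x $ i) * ?x $ i) \<bullet> 1 = (norm (?x $ i))\<^sup>2" for i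
    by (simp add: fconj_mult_self dot_square_norm)
  then have "line_projector L \<bullet> mat 1 = (\<Sum>i\<in>UNIV. (norm (?x $ i))\<^sup>2)"
    by (simp add: line_projector_def inner_vec_def mat_def if_distrib[of "\<lambda>z. _ \<bullet> z"] cong: if_cong)
  also have "\<dots> = (norm ?x)\<^sup>2" by (simp add: norm_vec_def L2_set_def sum_nonneg)
  finally show "line_projector L \<bullet> mat 1 = 1" using unit_rep_in[OF L] by simp
  show "0 \<le> line_projector L \<bullet> line_projector L'" by (simp add: inner_line_projector)
  show "proj_dist L L' = arccos (2 * (line_projector L \<bullet> line_projector L') - 1)"
    by (simp add: proj_dist_def inner_line_projector)
next
  have "(1 :: 'a) \<bullet> 1 = 1" by (simp add: dot_square_norm)
  then show "(mat 1 :: 'a ^ 'n ^ 'n) \<bullet> mat 1 = real (d + 1)"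
    using dim by (simp add: inner_vec_def mat_def if_distrib[of "\<lambda>z. _ \<bullet> z"] cong: if_cong)
next
  let ?r = "\<lambda>v :: real ^ 'n. (\<chi> i. of_real (v $ i)) :: 'a ^ 'n"
  have norm_r: "norm (?r v) = norm v" for v by (simp add: norm_vec_def)
  have in_line: "?r v \<in> real_line v" for v
    unfolding real_line_def line_def by (rule range_eqI[of _ _ 1]) (simp add: vec_eq_iff)
  have r_in: "real_line v \<in> (proj_space :: ('a ^ 'n) set set)" if "norm v = 1" for v
    unfolding proj_space_def real_line_def
    using norm_r[of v] that by (intro imageI) auto
  then show "real_line v \<in> (proj_space :: ('a ^ 'n) set set)" if "norm v = 1" for v :: "real ^ 'n"
    using that .
  fix v w :: "real ^ 'n" assume v: "norm v = 1" and w: "norm w = 1"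
  obtain a where a: "norm a = 1" "unit_rep (real_line v) = a *s ?r v"
    using unit_rep_scale[OF r_in[OF v] in_line] norm_r v by metis
  obtain b where b: "norm b = 1" "unit_rep (real_line w) = b *s ?r w"
    using unit_rep_scale[OF r_in[OF w] in_line] norm_r w by metis
  have "herm (?r v) (?r w) = of_real (v \<bullet> w)"
    by (simp add: herm_def fconj_of_real inner_vec_def)
  then show "line_projector (real_line v :: ('a ^ 'n) set) \<bullet> line_projector (real_line w) = (v \<bullet> w)\<^sup>2"
    by (simp add: inner_line_projector a b herm_scale norm_mult norm_fconj)
qed

section \<open>The Euclidean structure of the octonions\<close>

text \<open>
  With the inner product whose square norm is \<open>onormsq\<close>, the octonionic matrices form a Euclidean
  space, and the projectors of the octonionic projective spaces can be used as they are.
\<close>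

instantiation octonion :: real_vector
begin

definition scaleR_octonion :: "real \<Rightarrow> octonion \<Rightarrow> octonion" where
  "r *\<^sub>R x = Oct (r *\<^sub>R oL x) (r *\<^sub>R oR x)"

instance
  by standard (auto simp: octonion_eq_iff plus_octonion_def scaleR_octonion_def algebra_simps)

end

instantiation octonion :: real_inner
begin

definition inner_octonion :: "octonion \<Rightarrow> octonion \<Rightarrow> real" where
  "x \<bullet> y = oL x \<bullet> oL y + oR x \<bullet> oR y"
definition norm_octonion :: "octonion \<Rightarrow> real" where
  "norm x = sqrt (x \<bullet> x)" for x :: octonion
definition sgn_octonion :: "octonion \<Rightarrow> octonion" where
  "sgn x = x /\<^sub>R norm x" for x :: octonion
definition dist_octonion :: "octonion \<Rightarrow> octonion \<Rightarrow> real" where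
  "dist x y = norm (x - y)" for x y :: octonion
definition uniformity_octonion :: "(octonion \<times> octonion) filter" where
  "uniformity_octonion = (INF e\<in>{0<..}. principal {(x, y). dist x y < e})"
definition open_octonion :: "octonion set \<Rightarrow> bool" where
  "open_octonion U = (\<forall>x\<in>U. eventually (\<lambda>(x', y). x' = x \<longrightarrow> y \<in> U) uniformity)"

instance
proof
  fix x y z :: octonion and a b r :: real
  show "0 \<le> x \<bullet> x" by (simp add: inner_octonion_def)
  show "(x \<bullet> x = 0) = (x = 0)"
    by (auto simp: inner_octonion_def zero_octonion_def octonion_eq_iff add_nonneg_eq_0_iff)
qed (auto simp: octonion_eq_iff zero_octonion_def plus_octonion_def minus_octonion_def
    uminus_octonion_def scaleR_octonion_def inner_octonion_def norm_octonion_def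
    sgn_octonion_def dist_octonion_def uniformity_octonion_def open_octonion_def
    inner_commute algebra_simps)

end

instantiation octonion :: euclidean_space
begin

definition Basis_octonion :: "octonion set" where
  "Basis = (\<lambda>b. Oct b 0) ` Basis \<union> (\<lambda>b. Oct 0 b) ` Basis"

instance
proof
  show "(Basis :: octonion set) \<noteq> {}" "finite (Basis :: octonion set)"
    by (auto simp: Basis_octonion_def)
  fix u v :: octonion
  assume "u \<in> Basis" "v \<in> Basis"
  then show "u \<bullet> v = (if u = v then 1 else 0)"
    by (auto simp: Basis_octonion_def inner_octonion_def inner_Basis split: if_splits)
next
  fix x :: octonion
  have "(\<forall>u\<in>Basis. x \<bullet> u = 0) \<longleftrightarrow> (\<forall>u\<in>Basis. oL x \<bullet> u = 0) \<and> (\<forall>u\<in>Basis. oR x \<bullet> u = 0)"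
    by (simp add: Basis_octonion_def inner_octonion_def ball_Un)
  then show "(\<forall>u\<in>Basis. x \<bullet> u = 0) \<longleftrightarrow> x = 0"
    by (simp add: euclidean_all_zero_iff octonion_eq_iff zero_octonion_def)
qed

end

lemma fconj_quat_linear:
  "fconj (x + y) = fconj x + fconj (y :: quat)" "fconj (r *\<^sub>R x) = r *\<^sub>R fconj x"
  "fconj (- x) = - fconj x" "fconj (x - y) = fconj x - fconj y" "fconj (0 :: quat) = 0"
  by (simp_all add: fconj_quat_def plus_quat_def scaleR_quat_def uminus_quat_def minus_quat_def zero_quat_def)

lemma octonion_mult_linear:
  fixes x y z :: octonion
  shows "(x + y) * z = x * z + y * z" "z * (x + y) = z * x + z * y"
    "(x - y) * z = x * z - y * z" "z * (x - y) = z * x - z * y"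
    "(r *\<^sub>R x) * z = r *\<^sub>R (x * z)" "z * (r *\<^sub>R x) = r *\<^sub>R (z * x)"
  by (simp_all add: octonion_eq_iff times_octonion_def plus_octonion_def minus_octonion_def
      scaleR_octonion_def fconj_quat_linear algebra_simps)

lemma oconj_linear:
  "oconj (x + y) = oconj x + oconj y" "oconj (x - y) = oconj x - oconj y"
  "oconj (r *\<^sub>R x) = r *\<^sub>R oconj x"
  by (simp_all add: octonion_eq_iff oconj_def plus_octonion_def minus_octonion_def
      scaleR_octonion_def fconj_quat_linear)

lemma oconj_oconj [simp]: "oconj (oconj x) = x"
  by (simp add: oconj_def fconj_fconj octonion_eq_iff)

lemma onormsq_eq_inner: "onormsq x = x \<bullet> x"
  by (simp add: onormsq_def inner_octonion_def power2_norm_eq_inner)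

lemma octonion_inner_mult_self: "(x * y) \<bullet> (x * y) = (x \<bullet> x) * (y \<bullet> (y :: octonion))"
  using onormsq_mult[of x y] by (simp add: onormsq_eq_inner)

text \<open>
  Polarization of the composition property in one factor.  This replaces associativity in what
  follows.
\<close>

lemma octonion_inner_mult_left: "(a * b) \<bullet> (a * c) = (a \<bullet> a) * (b \<bullet> (c :: octonion))"
proof -
  have "(a * (b + c)) \<bullet> (a * (b + c)) = (a \<bullet> a) * ((b + c) \<bullet> (b + c))"
    by (rule octonion_inner_mult_self)
  then have "(a * b) \<bullet> (a * b) + (a * c) \<bullet> (a * c) + 2 * ((a * b) \<bullet> (a * c))
      = (a \<bullet> a) * (b \<bullet> b) + (a \<bullet> a) * (c \<bullet> c) + 2 * ((a \<bullet> a) * (b \<bullet> c))"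
    unfolding octonion_mult_linear by (simp add: inner_simps inner_commute algebra_simps)
  then show ?thesis by (simp add: octonion_inner_mult_self)
qed

lemma octonion_inner_mult_right: "(b * a) \<bullet> (c * a) = (b \<bullet> c) * (a \<bullet> (a :: octonion))"
proof -
  have "((b + c) * a) \<bullet> ((b + c) * a) = ((b + c) \<bullet> (b + c)) * (a \<bullet> a)"
    by (rule octonion_inner_mult_self)
  then have "(b * a) \<bullet> (b * a) + (c * a) \<bullet> (c * a) + 2 * ((b * a) \<bullet> (c * a))
      = (b \<bullet> b) * (a \<bullet> a) + (c \<bullet> c) * (a \<bullet> a) + 2 * ((b \<bullet> c) * (a \<bullet> a))"
    unfolding octonion_mult_linear by (simp add: inner_simps inner_commute algebra_simps)
  then show ?thesis by (simp add: octonion_inner_mult_self)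
qed

lemma octonion_inner_oconj [simp]: "oconj x \<bullet> oconj y = x \<bullet> y"
  by (simp add: inner_octonion_def oconj_def inner_quat_def fconj_quat_def uminus_quat_def)

lemma oRe_mult_oconj: "oRe (x * oconj y) = x \<bullet> y"
  by (simp add: oRe_def times_octonion_def oconj_def inner_octonion_def inner_quat_def
      fconj_quat_def times_quat_def minus_quat_def uminus_quat_def algebra_simps)

lemma oRe_linear: "oRe (x + y) = oRe x + oRe y" "oRe (r *\<^sub>R x) = r * oRe x" "oRe 0 = 0" "oRe 1 = 1"
  by (simp_all add: oRe_def plus_octonion_def scaleR_octonion_def zero_octonion_def one_octonion_def
      plus_quat_def scaleR_quat_def zero_quat_def one_quat_def)

lemma oRe_sum: "oRe (sum f A) = (\<Sum>i\<in>A. oRe (f i))"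
  by (induction A rule: infinite_finite_induct) (simp_all add: oRe_linear)

lemma octonion_inner_1: "x \<bullet> 1 = oRe x"
  by (simp add: inner_octonion_def one_octonion_def one_quat_def inner_quat_def oRe_def zero_quat_def)

lemma octonion_one_mult: "(1 :: octonion) * x = x"
  by (simp add: times_octonion_def one_octonion_def octonion_eq_iff fconj_quat_linear)

lemma octonion_mult_one: "x * (1 :: octonion) = x"
  by (simp add: times_octonion_def one_octonion_def octonion_eq_iff fconj_quat_linear)
     (simp add: fconj_quat_def one_quat_def times_quat_def quat_eq_iff)

lemma oconj_1: "oconj 1 = 1"
  by (simp add: oconj_def one_octonion_def fconj_quat_def one_quat_def zero_quat_def uminus_quat_def)

lemma oconj_fixed_imp_real: "x = oconj x \<Longrightarrow> x = oRe x *\<^sub>R 1"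
  by (auto simp: oconj_def octonion_eq_iff oRe_def scaleR_octonion_def one_octonion_def quat_eq_iff
      fconj_quat_def scaleR_quat_def one_quat_def zero_quat_def uminus_quat_def)

text \<open>
  For real numbers \<open>Y = A B\<close>.
  The parts of \<open>c\<close> along \<open>a\<close> and of \<open>e\<close> along \<open>b\<close> account for \<open>A B\<close> exactly,
  because polarized composition evaluates every inner product with a common factor.  What is left
  comes from the components of \<open>c\<close> and \<open>e\<close> orthogonal to \<open>a\<close> and \<open>b\<close> and is
  controlled by the Cauchy-Schwarz inequality.
\<close>

lemma octonion_inner_product_deviation:
  fixes a b c e :: octonion
  defines "A \<equiv> a \<bullet> c" and "B \<equiv> b \<bullet> e" and "Y \<equiv> (a * oconj b) \<bullet> (c * oconj e)"
  defines "r \<equiv> (a \<bullet> a) * (c \<bullet> c) - A\<^sup>2" and "s \<equiv> (b \<bullet> b) * (e \<bullet> e) - B\<^sup>2"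
  shows "(Y - A * B)\<^sup>2 \<le> r * s" "0 \<le> r" "0 \<le> s"
proof -
  show rs: "0 \<le> r" "0 \<le> s"
    using Cauchy_Schwarz_ineq[of a c] Cauchy_Schwarz_ineq[of b e] by (auto simp: r_def s_def A_def B_def)
  show "(Y - A * B)\<^sup>2 \<le> r * s"
  proof (cases "a = 0 \<or> b = 0")
    case True
    have "Y\<^sup>2 \<le> ((a * oconj b) \<bullet> (a * oconj b)) * ((c * oconj e) \<bullet> (c * oconj e))"
      unfolding Y_def by (rule Cauchy_Schwarz_ineq)
    also have "\<dots> = 0" using True by (auto simp: octonion_inner_mult_self)
    finally have "Y = 0" by simp
    moreover have "A * B = 0" using True by (auto simp: A_def B_def)
    ultimately show ?thesis using mult_nonneg_nonneg[OF rs] by (simp only:) simp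
  next
    case False
    define N where "N = a \<bullet> a" define K where "K = b \<bullet> b"
    have NK: "0 < N" "0 < K" using False by (auto simp: N_def K_def)
    \<comment> \<open>orthogonal components, scaled to avoid divisions\<close>
    define c' where "c' = N *\<^sub>R c - A *\<^sub>R a"
    define e' where "e' = K *\<^sub>R e - B *\<^sub>R b"
    have i: "(a * oconj b) \<bullet> (c * oconj b) = A * K" "(a * oconj b) \<bullet> (a * oconj e) = N * B"
      "(a * oconj b) \<bullet> (a * oconj b) = N * K"
      by (simp_all add: octonion_inner_mult_left octonion_inner_mult_right octonion_inner_mult_self
          A_def B_def N_def K_def)
    have "(a * oconj b) \<bullet> (c' * oconj e') = N * K * (Y - A * B)"
      unfolding c'_def e'_def oconj_linear octonion_mult_linear
      by (simp add: inner_simps i Y_def[symmetric] algebra_simps)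
    moreover have "c' \<bullet> c' = N * r"
      unfolding c'_def r_def by (simp add: inner_simps N_def[symmetric] A_def[symmetric] inner_commute[of c a] power2_eq_square algebra_simps)
    moreover have "e' \<bullet> e' = K * s"
      unfolding e'_def s_def by (simp add: inner_simps K_def[symmetric] B_def[symmetric] inner_commute[of e b] power2_eq_square algebra_simps)
    ultimately have "(N * K * (Y - A * B))\<^sup>2 \<le> (N * K) * ((N * r) * (K * s))"
      using Cauchy_Schwarz_ineq[of "a * oconj b" "c' * oconj e'"]
      by (simp add: octonion_inner_mult_self N_def K_def)
    then have "(N * K)\<^sup>2 * (Y - A * B)\<^sup>2 \<le> (N * K)\<^sup>2 * (r * s)"
      by (simp add: power_mult_distrib power2_eq_square mult_ac)
    then show ?thesis using NK by simp
  qed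
qed

text \<open>
  Over an associative algebra the expression would be \<open>\<bar>t + a\<^sup>* c + b\<^sup>* e\<bar>\<^sup>2\<close>.  Here it equals
  \<open>(t + A + B)\<^sup>2 + r + s + 2 (Y - A B)\<close> in the notation of the preceding lemma, and
  \<open>\<bar>Y - A B\<bar>\<close> is at most the geometric mean of \<open>r\<close> and \<open>s\<close>.
\<close>

lemma octonion_rank_one_form_nonneg:
  fixes a b c e :: octonion and t :: real
  shows "0 \<le> t\<^sup>2 + (a \<bullet> a) * (c \<bullet> c) + (b \<bullet> b) * (e \<bullet> e)
    + 2 * t * (a \<bullet> c) + 2 * t * (b \<bullet> e) + 2 * ((a * oconj b) \<bullet> (c * oconj e))"
proof -
  define A where "A = a \<bullet> c" define B where "B = b \<bullet> e"
  define Y where "Y = (a * oconj b) \<bullet> (c * oconj e)"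
  define r where "r = (a \<bullet> a) * (c \<bullet> c) - A\<^sup>2" define s where "s = (b \<bullet> b) * (e \<bullet> e) - B\<^sup>2"
  have rs: "(Y - A * B)\<^sup>2 \<le> r * s" "0 \<le> r" "0 \<le> s"
    unfolding A_def B_def Y_def r_def s_def by (rule octonion_inner_product_deviation)+
  have "(2 * (Y - A * B))\<^sup>2 \<le> 4 * (r * s)" using rs(1) unfolding power_mult_distrib by simp
  also have "\<dots> \<le> (r + s)\<^sup>2"
    using zero_le_power2[of "r - s"] by (simp add: power2_eq_square algebra_simps)
  finally have "\<bar>2 * (Y - A * B)\<bar> \<le> r + s" using rs by (simp add: abs_le_square_iff[symmetric])
  then have "0 \<le> r + s + 2 * (Y - A * B)" by linarith
  then have "0 \<le> (t + A + B)\<^sup>2 + (r + s + 2 * (Y - A * B))" by simp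
  also have "\<dots> = t\<^sup>2 + (a \<bullet> a) * (c \<bullet> c) + (b \<bullet> b) * (e \<bullet> e) + 2 * t * A + 2 * t * B + 2 * Y"
    by (simp add: r_def s_def power2_eq_square algebra_simps)
  finally show ?thesis by (simp add: A_def B_def Y_def)
qed

section \<open>The octonionic projective line and plane\<close>

context
  fixes P :: "octonion ^ 'n ^ 'n"
  assumes P: "P \<in> oct_proj_space"
begin

lemma oct_proj_herm: "P $ j $ i = oconj (P $ i $ j)"
  using P unfolding oct_proj_space_def by blast

lemma oct_proj_idem: "(\<Sum>k\<in>UNIV. P $ i $ k * P $ k $ j) = P $ i $ j"
proof -
  have "omat_mult P P = P" using P unfolding oct_proj_space_def by blast
  then have "omat_mult P P $ i $ j = P $ i $ j" by (rule arg_cong)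
  then show ?thesis by (simp add: omat_mult_def)
qed

lemma oct_proj_diag: "P $ i $ i = oRe (P $ i $ i) *\<^sub>R 1"
  using oct_proj_herm[of i i] by (rule oconj_fixed_imp_real)

lemma oct_proj_trace: "(\<Sum>i\<in>UNIV. oRe (P $ i $ i)) = 1"
proof -
  have "otrace P = 1" using P unfolding oct_proj_space_def by blast
  then have "oRe (otrace P) = oRe 1" by (rule arg_cong)
  then show ?thesis by (simp add: otrace_def oRe_sum oRe_linear)
qed

text \<open>
  The diagonal of the equation \<open>P P = P\<close>.
\<close>

lemma oct_proj_row: "(\<Sum>k\<in>UNIV. P $ i $ k \<bullet> P $ i $ k) = oRe (P $ i $ i)"
proof -
  have "oRe (\<Sum>k\<in>UNIV. P $ i $ k * P $ k $ i) = oRe (P $ i $ i)" by (simp only: oct_proj_idem)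
  moreover have "oRe (P $ i $ k * P $ k $ i) = P $ i $ k \<bullet> P $ i $ k" for k
    unfolding oct_proj_herm[of k i] by (rule oRe_mult_oconj)
  ultimately show ?thesis by (simp add: oRe_sum)
qed

lemma oct_proj_diag_nonneg: "0 \<le> oRe (P $ i $ i)"
  unfolding oct_proj_row[symmetric] by (simp add: sum_nonneg)

lemma oct_proj_diag_inner: "P $ i $ i \<bullet> P $ i $ i = (oRe (P $ i $ i))\<^sup>2"
proof -
  have "(1 :: octonion) \<bullet> 1 = 1" by (simp add: octonion_inner_1 oRe_linear)
  then show ?thesis
    by (subst (1 2) oct_proj_diag) (simp add: power2_eq_square)
qed

lemma oct_proj_minor_2:
  assumes U: "UNIV = {k, l}" and ne: "k \<noteq> l"
  shows "P $ l $ k \<bullet> P $ l $ k = oRe (P $ k $ k) * oRe (P $ l $ l)"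
proof -
  define x y where "x = oRe (P $ k $ k)" and "y = oRe (P $ l $ l)"
  have "y\<^sup>2 + P $ l $ k \<bullet> P $ l $ k = y"
    using oct_proj_row[of l] ne by (simp add: U oct_proj_diag_inner y_def)
  moreover have x: "x = 1 - y" using oct_proj_trace ne by (simp add: U x_def y_def)
  ultimately have "P $ l $ k \<bullet> P $ l $ k = x * y" unfolding x by (simp add: power2_eq_square algebra_simps)
  then show ?thesis by (simp add: x_def y_def)
qed

text \<open>
  The diagonal equations and the trace determine the three off-diagonal norms from the diagonal: this is
  the vanishing of the principal minors.  The off-diagonal equations then give the second part, where
  the trace condition moves the two diagonal terms to the left.  So a projector is determined by any
  column with nonzero diagonal entry, as a rank one matrix should be.
\<close>

lemma oct_proj_minor_3:
  assumes U: "UNIV = {k, l, m}" and ne: "k \<noteq> l" "k \<noteq> m" "l \<noteq> m"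
  shows "P $ l $ k \<bullet> P $ l $ k = oRe (P $ k $ k) * oRe (P $ l $ l)"
    and "oRe (P $ k $ k) *\<^sub>R P $ l $ m = P $ l $ k * oconj (P $ m $ k)"
proof -
  define x y z where "x = oRe (P $ k $ k)" and "y = oRe (P $ l $ l)" and "z = oRe (P $ m $ m)"
  define a b c where "a = P $ l $ k \<bullet> P $ l $ k" and "b = P $ m $ k \<bullet> P $ m $ k" and "c = P $ m $ l \<bullet> P $ m $ l"
  have abc: "P $ k $ l \<bullet> P $ k $ l = a" "P $ k $ m \<bullet> P $ k $ m = b" "P $ l $ m \<bullet> P $ l $ m = c"
    using oct_proj_herm[of k l] oct_proj_herm[of k m] oct_proj_herm[of l m] by (simp_all add: a_def b_def c_def)
  have tr: "x + y + z = 1" using oct_proj_trace ne by (simp add: U x_def y_def z_def)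
  have rows: "x\<^sup>2 + a + b = x" "a + y\<^sup>2 + c = y" "b + c + z\<^sup>2 = z"
    using oct_proj_row[of k] oct_proj_row[of l] oct_proj_row[of m] ne
    by (simp_all add: U oct_proj_diag_inner abc a_def[symmetric] b_def[symmetric] c_def[symmetric]
        x_def[symmetric] y_def[symmetric] z_def[symmetric])
  have z: "z = 1 - x - y" using tr by simp
  have "a = x * y" using rows unfolding z by (simp add: power2_eq_square algebra_simps)
  then show "P $ l $ k \<bullet> P $ l $ k = oRe (P $ k $ k) * oRe (P $ l $ l)"
    by (simp add: a_def x_def y_def)
  have "P $ l $ l * P $ l $ m = y *\<^sub>R P $ l $ m"
    unfolding y_def by (subst oct_proj_diag) (simp add: octonion_mult_linear octonion_one_mult)
  moreover have "P $ l $ m * P $ m $ m = z *\<^sub>R P $ l $ m"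
    unfolding z_def by (subst oct_proj_diag[of m]) (simp add: octonion_mult_linear octonion_mult_one)
  ultimately have sum: "P $ l $ k * P $ k $ m + (y *\<^sub>R P $ l $ m + z *\<^sub>R P $ l $ m) = P $ l $ m"
    using oct_proj_idem[of l m] ne by (simp add: U)
  have x: "x = 1 - y - z" using tr by simp
  have "x *\<^sub>R P $ l $ m = P $ l $ m - y *\<^sub>R P $ l $ m - z *\<^sub>R P $ l $ m"
    unfolding x by (simp add: scaleR_left_diff_distrib)
  also have "\<dots> = P $ l $ k * P $ k $ m"
    by (subst (1) sum[symmetric]) simp
  finally have "x *\<^sub>R P $ l $ m = P $ l $ k * P $ k $ m" .
  then show "oRe (P $ k $ k) *\<^sub>R P $ l $ m = P $ l $ k * oconj (P $ m $ k)"
    unfolding x_def oct_proj_herm[of k m] .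
qed

end

lemma oct_proj_minor:
  assumes P: "(P :: octonion ^ 'n ^ 'n) \<in> oct_proj_space" and card: "CARD('n::finite) \<in> {2, 3}" and ne: "k \<noteq> l"
  shows "P $ l $ k \<bullet> P $ l $ k = oRe (P $ k $ k) * oRe (P $ l $ l)"
proof -
  have fin: "finite (UNIV - {k, l})" by simp
  have c: "card (UNIV - {k, l}) = CARD('n) - 2" using ne by (subst card_Diff_subset) auto
  show ?thesis
  proof (cases "CARD('n) = 2")
    case True
    then have "UNIV - {k, l} = {}" using c fin by simp
    then have "UNIV = {k, l}" by blast
    then show ?thesis using oct_proj_minor_2[OF P] ne by blast
  next
    case False
    then have "card (UNIV - {k, l}) = 1" using c card by auto
    then obtain m where "UNIV - {k, l} = {m}" using card_1_singletonE by blast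
    then have "UNIV = {k, l, m}" "m \<noteq> k" "m \<noteq> l" by blast+
    then show ?thesis using oct_proj_minor_3(1)[OF P, of k l m] ne by blast
  qed
qed

text \<open>
  If \<open>P\<close> and \<open>Q\<close> have a common index \<open>k\<close> with nonzero diagonal entries \<open>p\<close> and
  \<open>q\<close>, both are recovered from their \<open>k\<close>-th columns, and \<open>p q (P \<bullet> Q)\<close> becomes the form
  of lemma \<open>octonion_rank_one_form_nonneg\<close> with \<open>t = p q\<close>.  Otherwise the vanishing minors show
  that \<open>P\<close> and \<open>Q\<close> have no nonzero entry in a common position.
\<close>

lemma oct_kernel_nonneg:
  assumes P: "(P :: octonion ^ 'n ^ 'n) \<in> oct_proj_space" and Q: "Q \<in> oct_proj_space"
    and card: "CARD('n::finite) \<in> {2, 3}"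
  shows "0 \<le> P \<bullet> Q"
proof (cases "\<exists>k. oRe (P $ k $ k) * oRe (Q $ k $ k) \<noteq> 0")
  case False
  have "P $ i $ j \<bullet> Q $ i $ j = 0" for i j
  proof -
    have 0: "oRe (P $ i $ i) * oRe (Q $ i $ i) = 0" using False by simp
    have "(P $ i $ j \<bullet> P $ i $ j) * (Q $ i $ j \<bullet> Q $ i $ j) = 0"
    proof (cases "i = j")
      case True
      then show ?thesis using 0 by (simp add: oct_proj_diag_inner[OF P] oct_proj_diag_inner[OF Q])
    next
      case False
      then show ?thesis using 0 by (auto simp: oct_proj_minor[OF P card] oct_proj_minor[OF Q card])
    qed
    then show ?thesis by auto
  qed
  then show ?thesis by (simp add: inner_vec_def)
next
  case True
  then obtain k where k: "oRe (P $ k $ k) * oRe (Q $ k $ k) \<noteq> 0" by blast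
  define p q where "p = oRe (P $ k $ k)" and "q = oRe (Q $ k $ k)"
  have pq: "0 < p * q"
    using k oct_proj_diag_nonneg[OF P, of k] oct_proj_diag_nonneg[OF Q, of k]
    by (simp add: p_def q_def less_le)
  have diag: "P $ i $ i \<bullet> Q $ i $ i = oRe (P $ i $ i) * oRe (Q $ i $ i)" for i
  proof -
    have "(1 :: octonion) \<bullet> 1 = 1" by (simp add: octonion_inner_1 oRe_linear)
    then show ?thesis by (subst oct_proj_diag[OF P], subst oct_proj_diag[OF Q]) simp
  qed
  have sym: "P $ j $ i \<bullet> Q $ j $ i = P $ i $ j \<bullet> Q $ i $ j" for i j
    by (simp add: oct_proj_herm[OF P, of j i] oct_proj_herm[OF Q, of j i])
  have norms: "(p * q) * (P $ l $ l \<bullet> Q $ l $ l) = (P $ l $ k \<bullet> P $ l $ k) * (Q $ l $ k \<bullet> Q $ l $ k)"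
    if "k \<noteq> l" for l
    by (simp add: diag oct_proj_minor[OF P card that] oct_proj_minor[OF Q card that] p_def q_def)
  have "\<exists>l. l \<noteq> k"
  proof (rule ccontr)
    assume "\<not> ?thesis"
    then have "(UNIV :: 'n set) = {k}" by blast
    then have "CARD('n) = card {k}" by (rule arg_cong)
    with card show False by simp
  qed
  then obtain l where l: "l \<noteq> k" by blast
  have c: "card (UNIV - {k, l}) = CARD('n) - 2" using l by (subst card_Diff_subset) auto
  have "0 \<le> (p * q) * (P \<bullet> Q)"
  proof (cases "CARD('n) = 2")
    case True
    then have "UNIV - {k, l} = {}" using c by simp
    then have U: "UNIV = {k, l}" by blast
    \<comment> \<open>the planar form with \<open>b = e = 0\<close>\<close>
    have "(p * q) * (P \<bullet> Q) = (p * q)\<^sup>2 + (p * q) * (P $ l $ l \<bullet> Q $ l $ l) + 2 * (p * q) * (P $ l $ k \<bullet> Q $ l $ k)"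
      using l sym[of k l] diag[of k]
      by (simp add: inner_vec_def U p_def[symmetric] q_def[symmetric] power2_eq_square algebra_simps)
    also have "\<dots> \<ge> 0"
      unfolding norms[OF l[symmetric]]
      using octonion_rank_one_form_nonneg[of "p * q" "P $ l $ k" "Q $ l $ k" 0 0]
      by (simp add: octonion_inner_mult_right)
    finally show ?thesis .
  next
    case False
    then have "card (UNIV - {k, l}) = 1" using c card by auto
    then obtain m where m: "UNIV - {k, l} = {m}" using card_1_singletonE by blast
    then have U: "UNIV = {k, l, m}" and ne: "k \<noteq> l" "k \<noteq> m" "l \<noteq> m" using l by blast+
    have "(p * q) * (P \<bullet> Q) = (p * q)\<^sup>2 + (p * q) * (P $ l $ l \<bullet> Q $ l $ l) + (p * q) * (P $ m $ m \<bullet> Q $ m $ m)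
        + 2 * (p * q) * (P $ l $ k \<bullet> Q $ l $ k) + 2 * (p * q) * (P $ m $ k \<bullet> Q $ m $ k)
        + 2 * ((p *\<^sub>R P $ l $ m) \<bullet> (q *\<^sub>R Q $ l $ m))"
      using ne sym[of k l] sym[of k m] sym[of m l] diag[of k]
      by (simp add: inner_vec_def U p_def[symmetric] q_def[symmetric] power2_eq_square algebra_simps)
    also have "\<dots> \<ge> 0"
      unfolding norms[OF ne(1)] norms[OF ne(2)]
        oct_proj_minor_3(2)[OF P U ne, folded p_def] oct_proj_minor_3(2)[OF Q U ne, folded q_def]
      by (rule octonion_rank_one_form_nonneg)
    finally show ?thesis .
  qed
  then show ?thesis using pq by (simp add: zero_le_mult_iff)
qed

definition real_oct_projector :: "real ^ 'n \<Rightarrow> octonion ^ 'n ^ 'n" where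
  "real_oct_projector v = (\<chi> i j. (v $ i * v $ j) *\<^sub>R 1)"

lemma oct_projector_embedding:
  assumes dim: "CARD('n::finite) = d + 1" and d: "d \<in> {1, 2}"
  shows "projector_embedding (oct_proj_space :: (octonion ^ 'n ^ 'n) set) oct_proj_dist
    (\<lambda>P. P) (mat 1) real_oct_projector d"
proof
  show "CARD('n) = d + 1" "d \<ge> 1" using dim d by auto
next
  fix P Q :: "octonion ^ 'n ^ 'n" assume P: "P \<in> oct_proj_space" and Q: "Q \<in> oct_proj_space"
  have "P \<bullet> P = (\<Sum>i\<in>UNIV. oRe (P $ i $ i))"
    by (simp add: inner_vec_def oct_proj_row[OF P])
  then show "P \<bullet> P = 1" by (simp only: oct_proj_trace[OF P])
  have "P \<bullet> mat 1 = (\<Sum>i\<in>UNIV. oRe (P $ i $ i))"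
    by (simp add: inner_vec_def mat_def if_distrib[of "\<lambda>z. _ \<bullet> z"] octonion_inner_1 cong: if_cong)
  then show "P \<bullet> mat 1 = 1" by (simp only: oct_proj_trace[OF P])
  show "0 \<le> P \<bullet> Q" by (rule oct_kernel_nonneg[OF P Q]) (use dim d in auto)
  have "oRe (P $ i $ k * Q $ k $ i) = P $ i $ k \<bullet> Q $ i $ k" "oRe (Q $ i $ k * P $ k $ i) = P $ i $ k \<bullet> Q $ i $ k" for i k
    unfolding oct_proj_herm[OF P, of k i] oct_proj_herm[OF Q, of k i] oRe_mult_oconj by (simp_all add: inner_commute)
  then have "oRe (otrace (omat_mult P Q + omat_mult Q P)) = 2 * (P \<bullet> Q)"
    by (simp add: otrace_def omat_mult_def oRe_sum oRe_linear inner_vec_def sum.distrib)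
  then show "oct_proj_dist P Q = arccos (2 * (P \<bullet> Q) - 1)" by (simp add: oct_proj_dist_def)
next
  show "(mat 1 :: octonion ^ 'n ^ 'n) \<bullet> mat 1 = real (d + 1)"
    using dim by (simp add: inner_vec_def mat_def if_distrib[of "\<lambda>z. _ \<bullet> z"] octonion_inner_1 oRe_linear cong: if_cong)
next
  fix v :: "real ^ 'n" assume "norm v = 1"
  then have v: "(\<Sum>k\<in>UNIV. v $ k * v $ k) = 1" by (simp add: norm_eq_1 inner_vec_def)
  have "(\<Sum>k\<in>UNIV. ((v $ i * v $ k) *\<^sub>R (1 :: octonion)) * ((v $ k * v $ j) *\<^sub>R 1)) = (v $ i * v $ j) *\<^sub>R 1" for i j
  proof -
    have "(\<Sum>k\<in>UNIV. ((v $ i * v $ k) *\<^sub>R (1 :: octonion)) * ((v $ k * v $ j) *\<^sub>R 1))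
        = (\<Sum>k\<in>UNIV. (v $ i * v $ j * (v $ k * v $ k)) *\<^sub>R 1)"
      by (simp add: octonion_mult_linear octonion_one_mult mult_ac)
    also have "\<dots> = (v $ i * v $ j * (\<Sum>k\<in>UNIV. v $ k * v $ k)) *\<^sub>R 1"
      by (simp only: scaleR_left.sum[symmetric] sum_distrib_left)
    finally show ?thesis by (simp add: v)
  qed
  moreover have "(\<Sum>i\<in>UNIV. (v $ i * v $ i) *\<^sub>R (1 :: octonion)) = 1"
    by (simp add: v flip: scaleR_left.sum)
  ultimately show "real_oct_projector v \<in> oct_proj_space"
    by (simp add: oct_proj_space_def real_oct_projector_def omat_mult_def otrace_def oconj_linear
        oconj_1 vec_eq_iff mult.commute)
next
  fix v w :: "real ^ 'n"
  show "real_oct_projector v \<bullet> real_oct_projector w = (v \<bullet> w)\<^sup>2"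
    by (simp add: real_oct_projector_def inner_vec_def octonion_inner_1 oRe_linear
        power2_eq_square sum_product mult_ac)
qed

section \<open>The threshold on the projective spaces\<close>

theorem theorem7p1:
  fixes d :: nat
  assumes "CARD('n::finite) = d + 1" and "d \<ge> 1"
  shows
    "(\<exists>!t. t \<in> {-2..-1} \<and> is_onb_threshold (proj_space :: (real ^ 'n) set set) proj_dist d t) \<and>
     (\<exists>!t. t \<in> {-2..-1} \<and> is_onb_threshold (proj_space :: (complex ^ 'n) set set) proj_dist d t) \<and>
     (\<exists>!t. t \<in> {-2..-1} \<and> is_onb_threshold (proj_space :: (quat ^ 'n) set set) proj_dist d t) \<and>
     (d \<in> {1, 2} \<longrightarrow>
       (\<exists>!t. t \<in> {-2..-1} \<and> is_onb_threshold (oct_proj_space :: (octonion ^ 'n ^ 'n) set) oct_proj_dist d t))"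
proof (intro conjI impI)
  show "\<exists>!t. t \<in> {-2..-1} \<and> is_onb_threshold (proj_space :: (real ^ 'n) set set) proj_dist d t"
    and "\<exists>!t. t \<in> {-2..-1} \<and> is_onb_threshold (proj_space :: (complex ^ 'n) set set) proj_dist d t"
    and "\<exists>!t. t \<in> {-2..-1} \<and> is_onb_threshold (proj_space :: (quat ^ 'n) set set) proj_dist d t"
    by (rule projector_embedding.unique_onb_threshold[OF line_projector_embedding[OF assms]])+
  show "\<exists>!t. t \<in> {-2..-1} \<and> is_onb_threshold (oct_proj_space :: (octonion ^ 'n ^ 'n) set) oct_proj_dist d t"
    if "d \<in> {1, 2}"
    by (rule projector_embedding.unique_onb_threshold[OF oct_projector_embedding[OF assms(1) that]])
qed

end
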